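(* Let $X=\sum_{\ell,m,s}a^\ell_{m,s}\phi^\ell_{m,s}$ be a random field on $SU(2)$. (a) If $X$ is $2$-weakly left-invariant (with $\mathbb{E}\|X\|^2>0$), then for all $\ell\in\frac12\mathbb{N}$ and $s\in\{-\ell,\dots,\ell\}$ the weak spectral probability $\Sigma\mathbb{E}[X]$ is uniform on the set $\{\ell\}\times\{-\ell,\dots,\ell\}\times\{s\}$, i.e. $\Sigma\mathbb{E}[X](\{(\ell,m,s)\})$ does not depend on $m$. (b) If $X$ is square integrable and strongly left-invariant (with $\|X\|>0$ almost surely), then the same is true for the strong spectral probability $\mathbb{E}\Sigma[X]$. (c) The analogous statements hold when $X$ is right-invariant ($2$-weakly, respectively strongly), in which case the measures are uniform on the sets of the form $\{\ell\}\times\{m\}\times\{-\ell,\dots,\ell\}$.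
   Context: $\frac12\mathbb{N}=\{0,\frac12,1,\dots\}$; $m,s\in\{-\ell,-\ell+1,\dots,\ell\}$. Elements of $SU(2)$ are $h(\alpha,\beta)=\begin{pmatrix}\alpha&-\overline\beta\\ \beta&\overline\alpha\end{pmatrix}$, $|\alpha|^2+|\beta|^2=1$; $SU(2)$ carries the metric of the round 3-sphere of radius 2; $\|\cdot\|$ is the $L^2(SU(2))$ norm. Wigner functions: with $\psi^\ell_m(z_0,z_1)=\binom{2\ell}{\ell+m}^{1/2}z_0^{\ell+m}z_1^{\ell-m}$, $D^\ell_{m,s}:SU(2)\to\mathbb{C}$ is defined by $\sum_m\psi^\ell_m(z_0,z_1)D^\ell_{m,s}(h(\alpha,\beta))=\psi^\ell_s(\overline\alpha z_0+\overline\beta z_1,-\beta z_0+\alpha z_1)$ for all $z_0,z_1\in\mathbb{C}$. The functions $\phi^\ell_{m,s}=\frac{\sqrt{2\ell+1}}{4\pi}D^\ell_{m,s}$ form an orthonormal basis of $L^2(SU(2))$. Random fields are jointly measurable $X:\Omega\times SU(2)\to\mathbb{C}$; square integrable means $X(\omega,\cdot)\in L^2(SU(2))$ almost surely. $X$ is strongly left- (right-) invariant if $X(g^{-1}\cdot)$ (resp. $X(\cdot\,g)$) has the same law as $X$ for all $g\in SU(2)$. $X$ is $2$-weakly left- (right-) invariant if $\mathbb{E}|X(g)|^2<\infty$ for all $g$ and, for every left (right) multiplication $\phi$ of $SU(2)$, $\mathbb{E}X(\phi(g))=\mathbb{E}X(g)$, $\mathbb{E}\{X(\phi(g_1))X(\phi(g_2))\}=\mathbb{E}\{X(g_1)X(g_2)\}$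 and $\mathbb{E}\{X(\phi(g_1))\overline{X(\phi(g_2))}\}=\mathbb{E}\{X(g_1)\overline{X(g_2)}\}$ for all $g,g_1,g_2$; such fields are almost surely in $L^2(SU(2))$. Spectral probabilities are measures on $\{(\ell,m,s):\ell\in\frac12\mathbb{N},\ m,s\in\{-\ell,\dots,\ell\}\}$: the weak one is $\Sigma\mathbb{E}[X](\{(\ell,m,s)\})=\mathbb{E}|a^\ell_{m,s}|^2/\mathbb{E}\|X\|^2$, the strong one is $\mathbb{E}\Sigma[X](\{(\ell,m,s)\})=\mathbb{E}\left(|a^\ell_{m,s}|^2/\|X\|^2\right)$. *)

theory Defs
  imports "HOL-Probability.Probability"
begin

section \<open>The group \<open>SU(2)\<close> and its volume measure\<close>

definition su2 :: "complex \<Rightarrow> complex \<Rightarrow> complex^2^2" where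
  "su2 \<alpha> \<beta> = vector [vector [\<alpha>, - cnj \<beta>], vector [\<beta>, cnj \<alpha>]]"

definition SU2 :: "(complex^2^2) set" where
  "SU2 = {su2 \<alpha> \<beta> | \<alpha> \<beta>. (cmod \<alpha>)\<^sup>2 + (cmod \<beta>)\<^sup>2 = 1}"

lemma su2_nth [simp]:
  "su2 \<alpha> \<beta> $ 1 $ 1 = \<alpha>" "su2 \<alpha> \<beta> $ 1 $ 2 = - cnj \<beta>"
  "su2 \<alpha> \<beta> $ 2 $ 1 = \<beta>" "su2 \<alpha> \<beta> $ 2 $ 2 = cnj \<alpha>"
  by (simp_all add: su2_def vector_2)

lemma SU2_eq_special_unitary:
  "SU2 = {A. A ** (\<chi> i j. cnj (A $ j $ i)) = mat 1 \<and> det A = 1}"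
proof (intro set_eqI iffI)
  fix A assume "A \<in> SU2"
  then obtain \<alpha> \<beta> where A: "A = su2 \<alpha> \<beta>" and n: "(cmod \<alpha>)\<^sup>2 + (cmod \<beta>)\<^sup>2 = 1"
    by (auto simp: SU2_def)
  have *: "\<alpha> * cnj \<alpha> + \<beta> * cnj \<beta> = 1"
    using arg_cong[OF n, of complex_of_real]
    by (simp only: of_real_add complex_norm_square of_real_1)
  show "A \<in> {A. A ** (\<chi> i j. cnj (A $ j $ i)) = mat 1 \<and> det A = 1}"
    using * by (simp add: A vec_eq_iff forall_2 matrix_matrix_mult_def sum_2 det_2 mat_def mult.commute
        add.commute)
next
  fix A :: "complex^2^2"
  assume "A \<in> {A. A ** (\<chi> i j. cnj (A $ j $ i)) = mat 1 \<and> det A = 1}"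
  then have u: "A ** (\<chi> i j. cnj (A $ j $ i)) = mat 1" and d: "det A = 1" by auto
  define a b c e where "a = A$1$1" and "b = A$1$2" and "c = A$2$1" and "e = A$2$2"
  have u1: "a * cnj a + b * cnj b = 1" and u2: "a * cnj c + b * cnj e = 0"
    and u3: "c * cnj a + e * cnj b = 0"
    and u4: "c * cnj c + e * cnj e = 1" and d1: "a * e - b * c = 1"
    using u d by (simp_all add: vec_eq_iff forall_2 matrix_matrix_mult_def sum_2 det_2 mat_def
        a_def b_def c_def e_def)
  have e: "e = cnj a" using u1 u3 d1 by algebra
  have "c = - cnj b" using u1 u3 d1 by algebra
  then have b: "b = - cnj c" by simp
  have "A = su2 a c"
    using e b by (simp add: vec_eq_iff forall_2 a_def b_def c_def e_def)
  moreover have "(cmod a)\<^sup>2 + (cmod c)\<^sup>2 = 1"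
  proof -
    have "complex_of_real ((cmod a)\<^sup>2 + (cmod c)\<^sup>2) = complex_of_real 1"
      using u4 by (simp only: of_real_add complex_norm_square of_real_1 e complex_cnj_cnj
          mult.commute add.commute)
    then show ?thesis by (simp only: of_real_eq_iff)
  qed
  ultimately show "A \<in> SU2" by (auto simp: SU2_def)
qed

text \<open>
  Riemannian volume of the round 3-sphere of radius 2, written as a cone measure: for a sphere of
  radius \<open>R\<close> in a Euclidean space of dimension \<open>d\<close>, a region has surface measure
  \<open>d * R ^ (d - 1)\<close> times the Lebesgue measure of the set of points of the unit ball whose direction
  lies in it. Here \<open>d = 4\<close>, the ambient space is \<open>complex \<times> complex\<close> and \<open>(\<alpha>, \<beta>)\<close> stands for the
  point \<open>2 (\<alpha>, \<beta>)\<close> of the sphere. The centre is removed because it has no direction.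
\<close>
definition SU2_vol :: "(complex^2^2) measure" where
  "SU2_vol = scale_measure (4 * 2 ^ 3)
     (distr (restrict_space lborel (ball (0 :: complex \<times> complex) 1 - {0}))
        (restrict_space borel SU2)
        (\<lambda>p. su2 (fst (sgn p)) (snd (sgn p))))"

lemma space_SU2_vol [simp]: "space SU2_vol = SU2"
  by (simp add: SU2_vol_def space_scale_measure space_restrict_space)

lemma sets_SU2_vol [measurable_cong]: "sets SU2_vol = sets (restrict_space borel SU2)"
  by (simp add: SU2_vol_def)

lemma measurable_su2_direction:
  "(\<lambda>p. su2 (fst (sgn p)) (snd (sgn p)))
     \<in> measurable (restrict_space lborel (ball (0 :: complex \<times> complex) 1 - {0}))
                  (restrict_space borel SU2)"
proof (rule measurable_restrict_space2)
  have "su2 (fst (sgn p)) (snd (sgn p)) \<in> SU2" if "p \<noteq> 0" for p :: "complex \<times> complex"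
  proof -
    have "norm (sgn p) = 1" using that by (simp add: norm_sgn)
    then have "(cmod (fst (sgn p)))\<^sup>2 + (cmod (snd (sgn p)))\<^sup>2 = 1"
      by (simp add: norm_prod_def)
    then show ?thesis by (auto simp: SU2_def)
  qed
  then show "(\<lambda>p. su2 (fst (sgn p)) (snd (sgn p)))
      \<in> space (restrict_space lborel (ball (0 :: complex \<times> complex) 1 - {0})) \<rightarrow> SU2"
    by (auto simp: space_restrict_space)
  have su2_alt: "su2 a b = (\<chi> i j. if i = 1 then if j = 1 then a else - cnj b
      else if j = 1 then b else cnj a)" for a b
    by (simp add: vec_eq_iff forall_2)
  have cont: "continuous_on (UNIV - {0})
      (\<lambda>p::complex \<times> complex. su2 (fst (sgn p)) (snd (sgn p)))"
  proof -
    have sgn: "continuous_on (UNIV - {0}) (\<lambda>p::complex \<times> complex. sgn p)"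
      unfolding sgn_div_norm by (intro continuous_intros) auto
    have "continuous_on (UNIV - {0}) (\<lambda>p::complex \<times> complex.
        if i = (1::2) then if j = (1::2) then fst (sgn p) else - cnj (snd (sgn p))
        else if j = 1 then snd (sgn p) else cnj (fst (sgn p)))" for i j
      by (cases "i = 1"; cases "j = 1") (simp_all, (intro continuous_intros sgn)+)
    then show ?thesis
      unfolding su2_alt by (intro continuous_on_vec_lambda)
  qed
  have "continuous_on (ball 0 1 - {0})
      (\<lambda>p::complex \<times> complex. su2 (fst (sgn p)) (snd (sgn p)))"
    by (rule continuous_on_subset[OF cont]) auto
  then have "(\<lambda>p::complex \<times> complex. su2 (fst (sgn p)) (snd (sgn p)))
      \<in> borel_measurable (restrict_space borel (ball 0 1 - {0}))"
    by (rule borel_measurable_continuous_on_restrict)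
  then show "(\<lambda>p. su2 (fst (sgn p)) (snd (sgn p)))
      \<in> borel_measurable (restrict_space lborel (ball (0 :: complex \<times> complex) 1 - {0}))"
    by (simp cong: measurable_cong_sets)
qed

lemma emeasure_SU2_vol_SU2: "emeasure SU2_vol SU2 = ennreal (16 * pi\<^sup>2)"
proof -
  let ?B = "ball (0 :: complex \<times> complex) 1"
  have "emeasure SU2_vol SU2 = 32 * emeasure (distr (restrict_space lborel (?B - {0}))
      (restrict_space borel SU2) (\<lambda>p. su2 (fst (sgn p)) (snd (sgn p)))) SU2"
    by (simp add: SU2_vol_def)
  also have "\<dots> = 32 * emeasure (restrict_space lborel (?B - {0})) (space (restrict_space lborel (?B - {0})))"
  proof -
    let ?N = "restrict_space lborel (?B - {0})"
    let ?f = "\<lambda>p :: complex \<times> complex. su2 (fst (sgn p)) (snd (sgn p))"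
    have S: "space (restrict_space borel SU2) = SU2" by (simp add: space_restrict_space)
    have "?f -` SU2 \<inter> space ?N = space ?N"
      using measurable_space[OF measurable_su2_direction] unfolding S by blast
    moreover have "SU2 \<in> sets (restrict_space borel SU2)"
      using sets.top[of "restrict_space borel SU2"] unfolding S .
    ultimately show ?thesis
      by (simp only: emeasure_distr[OF measurable_su2_direction])
  qed
  also have "\<dots> = 32 * emeasure lborel (?B - {0})"
    by (simp add: space_restrict_space emeasure_restrict_space)
  also have "emeasure lborel (?B - {0}) = emeasure lborel ?B"
    by (subst emeasure_Diff) auto
  also have "\<dots> = ennreal (pi\<^sup>2 / 2)"
    using emeasure_ball[of 1 "0 :: complex \<times> complex"] by (simp add: unit_ball_vol_numeral)
  finally show ?thesis
    using ennreal_mult[of 32 "pi\<^sup>2 / 2"] by simp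
qed


section \<open>Wigner functions\<close>

definition half_nats :: "real set" where
  "half_nats = {l. 2 * l \<in> \<nat>}"

definition weights :: "real \<Rightarrow> real set" where
  "weights l = {- l + real k | k. real k \<le> 2 * l}"

text \<open>For \<open>l \<in> half_nats\<close> and \<open>m \<in> weights l\<close> the numbers \<open>2 * l\<close>, \<open>l + m\<close> and \<open>l - m\<close> are natural
  numbers, so that no rounding takes place.\<close>
definition wigner_psi :: "real \<Rightarrow> real \<Rightarrow> complex \<Rightarrow> complex \<Rightarrow> complex" where
  "wigner_psi l m z0 z1 =
     complex_of_real (sqrt (real (nat \<lfloor>2 * l\<rfloor> choose nat \<lfloor>l + m\<rfloor>)))
       * z0 ^ nat \<lfloor>l + m\<rfloor> * z1 ^ nat \<lfloor>l - m\<rfloor>"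

text \<open>The parameters \<open>\<alpha>\<close>, \<open>\<beta>\<close> of a group element are the entries of its first column. The
  requirement outside \<open>weights l\<close> only serves to make the family of coefficients unique.\<close>
definition wigner_D :: "real \<Rightarrow> real \<Rightarrow> real \<Rightarrow> complex^2^2 \<Rightarrow> complex" where
  "wigner_D l m s g = (THE c.
      (\<forall>m'. m' \<notin> weights l \<longrightarrow> c m' = 0) \<and>
      (\<forall>z0 z1. (\<Sum>m'\<in>weights l. wigner_psi l m' z0 z1 * c m') =
         wigner_psi l s (cnj (g$1$1) * z0 + cnj (g$2$1) * z1) (- (g$2$1) * z0 + g$1$1 * z1))) m"

definition wigner_phi :: "real \<Rightarrow> real \<Rightarrow> real \<Rightarrow> complex^2^2 \<Rightarrow> complex" where
  "wigner_phi l m s g = complex_of_real (sqrt (2 * l + 1) / (4 * pi)) * wigner_D l m s g"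

lemma weights_eq_image:
  assumes "2 * l = real n"
  shows "weights l = (\<lambda>k. - l + real k) ` {..n}"
  using assms by (auto simp: weights_def)

lemma linear_times_homogeneous:
  fixes a b :: complex and e :: "nat \<Rightarrow> complex"
  shows "\<exists>e'. \<forall>x y. (a * x + b * y) * (\<Sum>k\<le>N. e k * x ^ k * y ^ (N - k)) =
     (\<Sum>k\<le>Suc N. e' k * x ^ k * y ^ (Suc N - k))"
proof (rule exI[where x =
      "\<lambda>k. (if k = 0 then 0 else a * e (k - 1)) + (if k \<le> N then b * e k else 0)"], intro allI)
  fix x y
  have 1: "(\<Sum>k\<le>Suc N. (if k = 0 then 0 else a * e (k - 1)) * x ^ k * y ^ (Suc N - k)) =
      a * x * (\<Sum>k\<le>N. e k * x ^ k * y ^ (N - k))"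
    by (subst sum.atMost_Suc_shift) (simp add: sum_distrib_left algebra_simps)
  have 2: "(\<Sum>k\<le>Suc N. (if k \<le> N then b * e k else 0) * x ^ k * y ^ (Suc N - k)) =
      b * y * (\<Sum>k\<le>N. e k * x ^ k * y ^ (N - k))"
    by (subst sum.atMost_Suc) (auto simp: sum_distrib_left algebra_simps Suc_diff_le intro!: sum.cong)
  show "(a * x + b * y) * (\<Sum>k\<le>N. e k * x ^ k * y ^ (N - k)) =
     (\<Sum>k\<le>Suc N. ((if k = 0 then 0 else a * e (k - 1)) + (if k \<le> N then b * e k else 0))
        * x ^ k * y ^ (Suc N - k))"
    by (simp only: distrib_right sum.distrib 1 2)
qed

lemma product_of_linear_forms_homogeneous:
  fixes a b c d :: complex
  shows "\<exists>e. \<forall>x y. (a * x + b * y) ^ i * (c * x + d * y) ^ j =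
     (\<Sum>k\<le>i + j. e k * x ^ k * y ^ (i + j - k))"
proof (induction i)
  case 0
  show ?case
  proof (induction j)
    case 0
    show ?case by (rule exI[of _ "\<lambda>_. 1"]) simp
  next
    case (Suc j)
    then obtain e where e: "\<And>x y. (c * x + d * y) ^ j = (\<Sum>k\<le>j. e k * x ^ k * y ^ (j - k))"
      by auto
    show ?case using linear_times_homogeneous[of c d e j] by (simp add: e)
  qed
next
  case (Suc i)
  then obtain e where e: "\<And>x y. (a * x + b * y) ^ i * (c * x + d * y) ^ j =
     (\<Sum>k\<le>i + j. e k * x ^ k * y ^ (i + j - k))" by auto
  show ?case using linear_times_homogeneous[of a b e "i + j"]
    by (simp add: mult.assoc e del: sum.atMost_Suc)
qed

lemma wigner_D_ex1:
  assumes l: "l \<in> half_nats" and s: "s \<in> weights l"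
  shows "\<exists>!c. (\<forall>m. m \<notin> weights l \<longrightarrow> c m = 0) \<and>
      (\<forall>z0 z1. (\<Sum>m\<in>weights l. wigner_psi l m z0 z1 * c m) =
         wigner_psi l s (cnj \<alpha> * z0 + cnj \<beta> * z1) (- \<beta> * z0 + \<alpha> * z1))"
proof -
  obtain n where n: "2 * l = real n" using l by (auto simp: half_nats_def Nats_def)
  obtain j where j: "s = - l + real j" "j \<le> n" using s n by (auto simp: weights_def)
  have inj: "inj_on (\<lambda>k. - l + real k) A" for A by (auto simp: inj_on_def)
  have W: "weights l = (\<lambda>k. - l + real k) ` {..n}" by (rule weights_eq_image[OF n])
  define B where "B k = complex_of_real (sqrt (real (n choose k)))" for k
  have psi: "wigner_psi l (- l + real k) x y = B k * x ^ k * y ^ (n - k)" if "k \<le> n" for k x y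
  proof -
    have "l - (- l + real k) = real (n - k)" using n that by (simp add: of_nat_diff)
    then show ?thesis by (simp add: wigner_psi_def n B_def del: of_nat_diff)
  qed
  have B0: "B k \<noteq> 0" if "k \<le> n" for k using that by (simp add: B_def)
  have S: "(\<Sum>m\<in>weights l. wigner_psi l m x y * c m) =
      (\<Sum>k\<le>n. (B k * c (- l + real k)) * x ^ k * y ^ (n - k))" for c x y
    unfolding W sum.reindex[OF inj] o_def
    by (intro sum.cong refl) (simp only: psi atMost_iff mult_ac)
  obtain e where e: "\<And>x y. (cnj \<alpha> * x + cnj \<beta> * y) ^ j * (- \<beta> * x + \<alpha> * y) ^ (n - j) =
      (\<Sum>k\<le>n. e k * x ^ k * y ^ (n - k))"
    using product_of_linear_forms_homogeneous[of "cnj \<alpha>" "cnj \<beta>" j "- \<beta>" \<alpha> "n - j"] j(2) by auto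
  define c0 where "c0 m = (if m \<in> weights l then
      B j * e (nat \<lfloor>l + m\<rfloor>) / B (nat \<lfloor>l + m\<rfloor>) else 0)" for m
  show ?thesis
  proof (rule ex1I[of _ c0], intro conjI allI impI)
    fix x y
    have "(\<Sum>m\<in>weights l. wigner_psi l m x y * c0 m) =
        (\<Sum>k\<le>n. B j * (e k * x ^ k * y ^ (n - k)))"
      unfolding S using B0 by (intro sum.cong) (auto simp: c0_def W)
    also have "\<dots> = B j * ((cnj \<alpha> * x + cnj \<beta> * y) ^ j * (- \<beta> * x + \<alpha> * y) ^ (n - j))"
      by (simp only: e sum_distrib_left)
    finally show "(\<Sum>m\<in>weights l. wigner_psi l m x y * c0 m) =
        wigner_psi l s (cnj \<alpha> * x + cnj \<beta> * y) (- \<beta> * x + \<alpha> * y)"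
      by (simp only: j(1) psi[OF j(2)] mult.assoc)
  next
    fix c
    assume c: "(\<forall>m. m \<notin> weights l \<longrightarrow> c m = 0) \<and>
      (\<forall>z0 z1. (\<Sum>m\<in>weights l. wigner_psi l m z0 z1 * c m) =
         wigner_psi l s (cnj \<alpha> * z0 + cnj \<beta> * z1) (- \<beta> * z0 + \<alpha> * z1))"
    have "(\<Sum>k\<le>n. (B k * c (- l + real k)) * x ^ k) = (\<Sum>k\<le>n. (B j * e k) * x ^ k)" for x
    proof -
      have "(\<Sum>k\<le>n. (B k * c (- l + real k)) * x ^ k * 1 ^ (n - k)) =
          wigner_psi l s (cnj \<alpha> * x + cnj \<beta> * 1) (- \<beta> * x + \<alpha> * 1)"
        using c unfolding S by blast
      also have "\<dots> = B j * ((cnj \<alpha> * x + cnj \<beta> * 1) ^ j * (- \<beta> * x + \<alpha> * 1) ^ (n - j))"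
        by (simp only: j(1) psi[OF j(2)] mult.assoc)
      also have "\<dots> = (\<Sum>k\<le>n. (B j * e k) * x ^ k)"
        unfolding e by (simp add: sum_distrib_left mult.assoc)
      finally show ?thesis by simp
    qed
    then have coeffs: "\<forall>k\<le>n. B k * c (- l + real k) = B j * e k"
      using polyfun_eq_coeffs[of "\<lambda>k. B k * c (- l + real k)" n "\<lambda>k. B j * e k"] by blast
    have "c m = c0 m" for m
    proof (cases "m \<in> weights l")
      case True
      then obtain k where k: "m = - l + real k" "k \<le> n" unfolding W by blast
      have "B k * c m = B j * e k" using coeffs k by blast
      moreover have "c0 m = B j * e k / B k" using True k by (simp add: c0_def)
      ultimately show ?thesis using B0[OF k(2)]
        by (metis nonzero_mult_div_cancel_left)
    qed (use c in \<open>simp add: c0_def\<close>)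
    then show "c = c0" by blast
  qed (simp add: c0_def)
qed

lemma wigner_D_eq:
  assumes "l \<in> half_nats" "s \<in> weights l"
  shows "(\<Sum>m\<in>weights l. wigner_psi l m z0 z1 * wigner_D l m s (su2 \<alpha> \<beta>)) =
    wigner_psi l s (cnj \<alpha> * z0 + cnj \<beta> * z1) (- \<beta> * z0 + \<alpha> * z1)"
  using theI'[OF wigner_D_ex1[OF assms, of \<alpha> \<beta>]] unfolding wigner_D_def by simp


section \<open>Random fields on \<open>SU(2)\<close>\<close>

definition random_field :: "'w measure \<Rightarrow> ('w \<Rightarrow> complex^2^2 \<Rightarrow> complex) \<Rightarrow> bool" where
  "random_field M X \<longleftrightarrow> prob_space M \<and>
     (\<lambda>(\<omega>, g). X \<omega> g) \<in> borel_measurable (M \<Otimes>\<^sub>M restrict_space borel SU2)"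

text \<open>The law of a field is its distribution on the product \<open>\<sigma>\<close>-algebra of the space of functions
  on \<open>SU(2)\<close>, so that equality of laws is equality of all finite-dimensional distributions.\<close>
definition field_law ::
  "'w measure \<Rightarrow> ('w \<Rightarrow> complex^2^2 \<Rightarrow> complex) \<Rightarrow> (complex^2^2 \<Rightarrow> complex) measure" where
  "field_law M X = distr M (\<Pi>\<^sub>M g\<in>SU2. borel) (\<lambda>\<omega>. restrict (X \<omega>) SU2)"

definition strongly_left_invariant :: "'w measure \<Rightarrow> ('w \<Rightarrow> complex^2^2 \<Rightarrow> complex) \<Rightarrow> bool" where
  "strongly_left_invariant M X \<longleftrightarrow>
     (\<forall>g\<in>SU2. field_law M (\<lambda>\<omega> x. X \<omega> (matrix_inv g ** x)) = field_law M X)"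

definition strongly_right_invariant :: "'w measure \<Rightarrow> ('w \<Rightarrow> complex^2^2 \<Rightarrow> complex) \<Rightarrow> bool" where
  "strongly_right_invariant M X \<longleftrightarrow>
     (\<forall>g\<in>SU2. field_law M (\<lambda>\<omega> x. X \<omega> (x ** g)) = field_law M X)"

definition weakly2_invariant ::
  "(complex^2^2 \<Rightarrow> complex^2^2) set \<Rightarrow> 'w measure \<Rightarrow> ('w \<Rightarrow> complex^2^2 \<Rightarrow> complex) \<Rightarrow> bool" where
  "weakly2_invariant T M X \<longleftrightarrow>
     (\<forall>g\<in>SU2. integrable M (\<lambda>\<omega>. (cmod (X \<omega> g))\<^sup>2)) \<and>
     (\<forall>\<phi>\<in>T.
        (\<forall>g\<in>SU2. (\<integral>\<omega>. X \<omega> (\<phi> g) \<partial>M) = (\<integral>\<omega>. X \<omega> g \<partial>M)) \<and>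
        (\<forall>g1\<in>SU2. \<forall>g2\<in>SU2.
           (\<integral>\<omega>. X \<omega> (\<phi> g1) * X \<omega> (\<phi> g2) \<partial>M) = (\<integral>\<omega>. X \<omega> g1 * X \<omega> g2 \<partial>M) \<and>
           (\<integral>\<omega>. X \<omega> (\<phi> g1) * cnj (X \<omega> (\<phi> g2)) \<partial>M) = (\<integral>\<omega>. X \<omega> g1 * cnj (X \<omega> g2) \<partial>M)))"

definition weakly2_left_invariant :: "'w measure \<Rightarrow> ('w \<Rightarrow> complex^2^2 \<Rightarrow> complex) \<Rightarrow> bool" where
  "weakly2_left_invariant = weakly2_invariant ((\<lambda>h x. h ** x) ` SU2)"

definition weakly2_right_invariant :: "'w measure \<Rightarrow> ('w \<Rightarrow> complex^2^2 \<Rightarrow> complex) \<Rightarrow> bool" where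
  "weakly2_right_invariant = weakly2_invariant ((\<lambda>h x. x ** h) ` SU2)"

text \<open>The squared \<open>L\<^sup>2\<close> norm takes the value \<open>\<infinity>\<close> outside of \<open>L\<^sup>2(SU(2))\<close>.\<close>
definition L2_normsq :: "(complex^2^2 \<Rightarrow> complex) \<Rightarrow> ennreal" where
  "L2_normsq f = (\<integral>\<^sup>+ g. ennreal ((cmod (f g))\<^sup>2) \<partial>SU2_vol)"

definition square_integrable_field :: "'w measure \<Rightarrow> ('w \<Rightarrow> complex^2^2 \<Rightarrow> complex) \<Rightarrow> bool" where
  "square_integrable_field M X \<longleftrightarrow> (AE \<omega> in M. L2_normsq (X \<omega>) < \<infinity>)"

text \<open>The coefficient of \<open>f\<close> along the orthonormal basis element \<open>wigner_phi l m s\<close>.\<close>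
definition wigner_coeff :: "real \<Rightarrow> real \<Rightarrow> real \<Rightarrow> (complex^2^2 \<Rightarrow> complex) \<Rightarrow> complex" where
  "wigner_coeff l m s f = (\<integral>g. f g * cnj (wigner_phi l m s g) \<partial>SU2_vol)"


section \<open>Spectral probabilities\<close>

definition spectral_index :: "(real \<times> real \<times> real) set" where
  "spectral_index = {(l, m, s). l \<in> half_nats \<and> m \<in> weights l \<and> s \<in> weights l}"

definition weak_spectral_prob ::
  "'w measure \<Rightarrow> ('w \<Rightarrow> complex^2^2 \<Rightarrow> complex) \<Rightarrow> (real \<times> real \<times> real) measure" where
  "weak_spectral_prob M X = density (count_space spectral_index) (\<lambda>(l, m, s).
     (\<integral>\<^sup>+\<omega>. ennreal ((cmod (wigner_coeff l m s (X \<omega>)))\<^sup>2) \<partial>M) / (\<integral>\<^sup>+\<omega>. L2_normsq (X \<omega>) \<partial>M))"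

definition strong_spectral_prob ::
  "'w measure \<Rightarrow> ('w \<Rightarrow> complex^2^2 \<Rightarrow> complex) \<Rightarrow> (real \<times> real \<times> real) measure" where
  "strong_spectral_prob M X = density (count_space spectral_index) (\<lambda>(l, m, s).
     \<integral>\<^sup>+\<omega>. ennreal ((cmod (wigner_coeff l m s (X \<omega>)))\<^sup>2) / L2_normsq (X \<omega>) \<partial>M)"

lemma emeasure_weak_spectral_prob_singleton:
  assumes "(l, m, s) \<in> spectral_index"
  shows "emeasure (weak_spectral_prob M X) {(l, m, s)} =
    (\<integral>\<^sup>+\<omega>. ennreal ((cmod (wigner_coeff l m s (X \<omega>)))\<^sup>2) \<partial>M) / (\<integral>\<^sup>+\<omega>. L2_normsq (X \<omega>) \<partial>M)"
  using assms unfolding weak_spectral_prob_def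
  by (simp add: emeasure_density)

lemma emeasure_strong_spectral_prob_singleton:
  assumes "(l, m, s) \<in> spectral_index"
  shows "emeasure (strong_spectral_prob M X) {(l, m, s)} =
    (\<integral>\<^sup>+\<omega>. ennreal ((cmod (wigner_coeff l m s (X \<omega>)))\<^sup>2) / L2_normsq (X \<omega>) \<partial>M)"
  using assms unfolding strong_spectral_prob_def
  by (simp add: emeasure_density)

definition uniform_on :: "'a measure \<Rightarrow> 'a set \<Rightarrow> bool" where
  "uniform_on \<mu> S \<longleftrightarrow> (\<forall>p\<in>S. \<forall>q\<in>S. emeasure \<mu> {p} = emeasure \<mu> {q})"

end

theory Submission
  imports Defs
begin

text \<open>
  A translation of the field acts on the coefficients through the matrices \<open>D(h)\<close>. The row and the
  column of \<open>D(h)\<close> belonging to the lowest weight \<open>- l\<close> are explicit: up to phases their entries are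
  \<open>sqrt (n choose k) * \<alpha> ^ (n - k) * \<beta> ^ k\<close> with \<open>n = 2 * l\<close>. So by invariance the (weighted) second
  moment of the lowest coefficient equals that of this combination of all coefficients. Averaging over
  the phase of \<open>\<beta>\<close> removes the cross terms and leaves
  \<open>c 0 = (\<Sum>k\<le>n. (n choose k) * t ^ k * (1 - t) ^ (n - k) * c k)\<close> for all \<open>t\<close> in \<open>(0, 1)\<close>, where \<open>c k\<close> is
  the second moment of the \<open>k\<close>-th coefficient. Bernstein polynomials are linearly independent, hence
  \<open>c\<close> is constant.

  That invariance passes to these second moments is Fubini's theorem for the covariance kernel in the
  weak case. In the strong case the field is truncated, the reciprocal of its squared norm is expanded
  in a geometric series of integral functionals, and Fubini is applied to every term.
\<close>

section \<open>The group \<open>SU(2)\<close>\<close>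

text \<open>The lowest weight is chosen because both lines of \<open>D(h)\<close> can be read off
  the defining identity: inserting \<open>(0, 1)\<close> isolates the row, and for the column the
  right-hand side is a pure \<open>n\<close>-th power, expanded by the binomial theorem. The phase
  average is finite, over the roots of unity of order \<open>n + 1\<close>, which already separate
  the degrees 0 to \<open>n\<close>. Both kinds of invariance share one argument with a weight on
  the probability space: 1 in the weak case, the reciprocal of the squared norm in the strong case.
  Translating the field does not change the latter weight because translations preserve the volume;
  this is what the cone description of the volume is used for. In the strong case the obstacle is
  that a law on the product space only sees fixed points of the group, whereas coefficient and norm
  are integrals over the group. Truncation at height \<open>N\<close> makes all integrands bounded,
  so that Fubini applies on finite measure spaces, and it bounds the squared norm by
  \<open>N\<^sup>2 V\<close>, which puts the ratio of the geometric series into the interval from 0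
  to 1. Dominated convergence removes the truncation again.\<close>

lemma su2_in_SU2: "(cmod \<alpha>)\<^sup>2 + (cmod \<beta>)\<^sup>2 = 1 \<Longrightarrow> su2 \<alpha> \<beta> \<in> SU2"
  unfolding SU2_def by blast

lemma su2_mult:
  "su2 a b ** su2 c d = su2 (a * c - cnj b * d) (b * c + cnj a * d)"
  by (simp add: vec_eq_iff forall_2 matrix_matrix_mult_def sum_2 algebra_simps)

lemma mat_1_in_SU2: "mat 1 \<in> SU2"
proof -
  have "mat 1 = su2 1 0" by (simp add: vec_eq_iff forall_2 mat_def)
  then show ?thesis using su2_in_SU2[of 1 0] by simp
qed

text \<open>On \<open>SU2\<close> this is inversion, in an explicit form from which continuity and
  measurability are immediate; \<open>matrix_inv\<close> is defined by choice.\<close>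

definition conj_transpose :: "complex^'n^'m \<Rightarrow> complex^'m^'n" where
  "conj_transpose A = (\<chi> i j. cnj (A $ j $ i))"

lemma conj_transpose_su2: "conj_transpose (su2 a b) = su2 (cnj a) (- b)"
  by (simp add: vec_eq_iff forall_2 conj_transpose_def)

lemma SU2_mult: "g \<in> SU2 \<Longrightarrow> h \<in> SU2 \<Longrightarrow> g ** h \<in> SU2"
proof -
  assume "g \<in> SU2" "h \<in> SU2"
  then obtain a b c d where g: "g = su2 a b" "(cmod a)\<^sup>2 + (cmod b)\<^sup>2 = 1"
    and h: "h = su2 c d" "(cmod c)\<^sup>2 + (cmod d)\<^sup>2 = 1"
    by (auto simp: SU2_def)
  have "complex_of_real ((cmod (a * c - cnj b * d))\<^sup>2 + (cmod (b * c + cnj a * d))\<^sup>2) =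
      complex_of_real (((cmod a)\<^sup>2 + (cmod b)\<^sup>2) * ((cmod c)\<^sup>2 + (cmod d)\<^sup>2))"
    unfolding of_real_add of_real_mult complex_norm_square by (simp add: algebra_simps)
  then have "(cmod (a * c - cnj b * d))\<^sup>2 + (cmod (b * c + cnj a * d))\<^sup>2 = 1"
    unfolding of_real_eq_iff using g h by simp
  then show ?thesis unfolding g h su2_mult SU2_def by blast
qed

lemma SU2_conj_transpose: "g \<in> SU2 \<Longrightarrow> conj_transpose g \<in> SU2"
  by (auto simp: SU2_def conj_transpose_su2) (metis complex_mod_cnj norm_minus_cancel)

lemma SU2_conj_transpose_mult:
  assumes "g \<in> SU2"
  shows "conj_transpose g ** g = mat 1" "g ** conj_transpose g = mat 1"
proof -
  obtain a b where g: "g = su2 a b" "(cmod a)\<^sup>2 + (cmod b)\<^sup>2 = 1"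
    using assms by (auto simp: SU2_def)
  have "a * cnj a + b * cnj b = 1"
    using arg_cong[OF g(2), of complex_of_real]
    by (simp only: of_real_add complex_norm_square of_real_1)
  then show "conj_transpose g ** g = mat 1" "g ** conj_transpose g = mat 1"
    unfolding g conj_transpose_su2 su2_mult
    by (simp_all add: vec_eq_iff forall_2 mat_def algebra_simps)
qed

lemma matrix_inv_SU2: "g \<in> SU2 \<Longrightarrow> matrix_inv g = conj_transpose g"
  unfolding matrix_inv_def
  by (rule some_equality)
     (auto simp: SU2_conj_transpose_mult, metis SU2_conj_transpose_mult(1) matrix_mul_assoc matrix_mul_lid matrix_mul_rid)

lemma conj_transpose_conj_transpose [simp]: "conj_transpose (conj_transpose A) = A"
  by (simp add: conj_transpose_def vec_eq_iff)

lemma conj_transpose_mult: "conj_transpose (A ** B) = conj_transpose B ** conj_transpose A"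
  by (simp add: conj_transpose_def vec_eq_iff matrix_matrix_mult_def mult.commute)

lemma measurable_restrict_SU2:
  assumes "continuous_on UNIV T" "\<And>x. x \<in> SU2 \<Longrightarrow> T x \<in> SU2"
  shows "T \<in> measurable (restrict_space borel SU2) (restrict_space borel SU2)"
  using assms
  by (intro measurable_restrict_space2)
     (auto simp: space_restrict_space intro!: measurable_restrict_space1 borel_measurable_continuous_onI)

lemma measurable_SU2_mult_left:
  "h \<in> SU2 \<Longrightarrow> (\<lambda>x. h ** x) \<in> measurable (restrict_space borel SU2) (restrict_space borel SU2)"
  by (intro measurable_restrict_SU2 SU2_mult)
     (auto simp: matrix_matrix_mult_def intro!: continuous_intros)

lemma measurable_SU2_conj_transpose:
  "conj_transpose \<in> measurable (restrict_space borel SU2) (restrict_space borel SU2)"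
  by (intro measurable_restrict_SU2 SU2_conj_transpose)
     (auto simp: conj_transpose_def intro!: continuous_intros)

lemma measurable_SU2_mult_right:
  "h \<in> SU2 \<Longrightarrow> (\<lambda>x. x ** h) \<in> measurable (restrict_space borel SU2) (restrict_space borel SU2)"
  by (intro measurable_restrict_SU2 SU2_mult)
     (auto simp: matrix_matrix_mult_def intro!: continuous_intros)

section \<open>Invariance of the volume\<close>

definition preserves_lborel :: "('a::euclidean_space \<Rightarrow> 'a) \<Rightarrow> bool" where
  "preserves_lborel L \<longleftrightarrow> L \<in> borel_measurable borel \<and> distr lborel borel L = lborel"

lemma preserves_lborel_comp:
  assumes "preserves_lborel L" "preserves_lborel K"
  shows "preserves_lborel (L \<circ> K)"
proof -
  have "distr lborel borel (L \<circ> K) = distr (distr lborel borel K) borel L"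
    using assms by (subst distr_distr) (auto simp: preserves_lborel_def)
  then show ?thesis using assms by (auto simp: preserves_lborel_def intro: measurable_comp)
qed

text \<open>Tonelli over the second coordinate: the slice at \<open>y\<close> of the preimage is the
  preimage under \<open>T y\<close> of the slice at \<open>y\<close>, hence has the same measure.
  Joint measurability is a separate assumption, as measurability of every \<open>T y\<close> does
  not imply it.\<close>

lemma preserves_lborel_fibrewise:
  fixes T :: "'b::euclidean_space \<Rightarrow> 'a::euclidean_space \<Rightarrow> 'a"
  assumes m: "(\<lambda>p. (T (snd p) (fst p), snd p)) \<in> borel_measurable borel"
    and T: "\<And>y. preserves_lborel (T y)"
  shows "preserves_lborel (\<lambda>p. (T (snd p) (fst p), snd p))"
proof -
  let ?T = "\<lambda>p. (T (snd p) (fst p), snd p)"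
  have "distr lborel borel ?T = lborel"
  proof (rule measure_eqI)
    fix A assume "A \<in> sets (distr lborel borel ?T)"
    then have A [measurable]: "A \<in> sets borel" by simp
    have A': "A \<in> sets (lborel \<Otimes>\<^sub>M lborel)"
      unfolding lborel_prod sets_lborel by (rule A)
    have TA: "?T -` A \<in> sets (lborel \<Otimes>\<^sub>M lborel)"
      unfolding lborel_prod sets_lborel using measurable_sets[OF m A] by simp
    have "emeasure (distr lborel borel ?T) A = emeasure lborel (?T -` A)"
      using m by (subst emeasure_distr) auto
    also have "\<dots> = (\<integral>\<^sup>+y. emeasure lborel ((\<lambda>x. (x, y)) -` (?T -` A)) \<partial>lborel)"
      using lborel_pair.emeasure_pair_measure_alt2[OF TA] by (simp add: lborel_prod)
    also have "\<dots> = (\<integral>\<^sup>+y. emeasure lborel ((\<lambda>x. (x, y)) -` A) \<partial>lborel)"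
    proof (rule nn_integral_cong)
      fix y
      have "emeasure lborel ((\<lambda>x. (x, y)) -` A) =
          emeasure (distr lborel borel (T y)) ((\<lambda>x. (x, y)) -` A)"
        using T[of y] by (simp add: preserves_lborel_def)
      also have "\<dots> = emeasure lborel (T y -` ((\<lambda>x. (x, y)) -` A))"
        using sets_Pair2[OF A', of y] T[of y]
        by (subst emeasure_distr) (auto simp: preserves_lborel_def)
      also have "T y -` ((\<lambda>x. (x, y)) -` A) = (\<lambda>x. (x, y)) -` (?T -` A)"
        by auto
      finally show "emeasure lborel ((\<lambda>x. (x, y)) -` (?T -` A)) =
          emeasure lborel ((\<lambda>x. (x, y)) -` A)" by simp
    qed
    also have "\<dots> = emeasure lborel A"
      using lborel_pair.emeasure_pair_measure_alt2[OF A'] by (simp add: lborel_prod)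
    finally show "emeasure (distr lborel borel ?T) A = emeasure lborel A" .
  qed simp
  with m show ?thesis by (simp add: preserves_lborel_def)
qed

lemma preserves_lborel_swap:
  "preserves_lborel (\<lambda>p :: 'a::euclidean_space \<times> 'a. (snd p, fst p))"
proof -
  have "distr (lborel \<Otimes>\<^sub>M lborel) (lborel \<Otimes>\<^sub>M lborel) (\<lambda>(x, y). (y, x)) =
      (lborel \<Otimes>\<^sub>M lborel :: ('a \<times> 'a) measure)"
    by (rule lborel_pair.distr_pair_swap[symmetric])
  then have "distr lborel lborel (\<lambda>(x, y). (y, x)) = (lborel :: ('a \<times> 'a) measure)"
    by (simp only: lborel_prod)
  moreover have "distr lborel borel (\<lambda>p :: 'a \<times> 'a. (snd p, fst p)) =
      distr lborel lborel (\<lambda>(x, y). (y, x))"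
    by (rule distr_cong) auto
  moreover have "(\<lambda>p :: 'a \<times> 'a. (snd p, fst p)) \<in> borel_measurable borel"
    by (intro borel_measurable_continuous_onI continuous_intros)
  ultimately show ?thesis by (simp add: preserves_lborel_def)
qed

text \<open>On the fibre over \<open>y\<close> the shear is the translation by
  \<open>c * y\<close>.\<close>

lemma preserves_lborel_shear_fst:
  "preserves_lborel (\<lambda>p :: complex \<times> complex. (fst p + c * snd p, snd p))"
proof (rule preserves_lborel_fibrewise[where T = "\<lambda>y x. x + c * y"])
  show "(\<lambda>p :: complex \<times> complex. (fst p + c * snd p, snd p)) \<in> borel_measurable borel"
    by (intro borel_measurable_continuous_onI continuous_intros)
  show "preserves_lborel (\<lambda>x. x + c * y)" for y
    using lborel_distr_plus[of "c * y"]
    by (simp add: preserves_lborel_def add.commute[of _ "c * y"])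
qed

lemma preserves_lborel_shear_snd:
  "preserves_lborel (\<lambda>p :: complex \<times> complex. (fst p, snd p + c * fst p))"
proof -
  have "preserves_lborel ((\<lambda>p. (snd p, fst p)) \<circ>
      (\<lambda>p :: complex \<times> complex. (fst p + c * snd p, snd p)) \<circ> (\<lambda>p. (snd p, fst p)))"
    by (intro preserves_lborel_comp preserves_lborel_swap preserves_lborel_shear_fst)
  then show ?thesis by (simp add: comp_def)
qed

text \<open>Left multiplication by \<open>su2 a b\<close> in the coordinates given by the first
  column: \<open>su2 a b ** su2 x y\<close> has first column
  \<open>su2_act a b (x, y)\<close>.\<close>

definition su2_act :: "complex \<Rightarrow> complex \<Rightarrow> complex \<times> complex \<Rightarrow> complex \<times> complex" where
  "su2_act a b p = (a * fst p - cnj b * snd p, b * fst p + cnj a * snd p)"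

text \<open>Elements of \<open>SL(2)\<close> with nonzero lower left entry are products of three shears.\<close>

lemma preserves_lborel_su2_act:
  assumes "(cmod a)\<^sup>2 + (cmod b)\<^sup>2 = 1"
  shows "preserves_lborel (su2_act a b)"
proof -
  have nz: "preserves_lborel (su2_act a b)"
    if "(cmod a)\<^sup>2 + (cmod b)\<^sup>2 = 1" "b \<noteq> 0" for a b
  proof -
    \<comment> \<open>The product of the three shears has diagonal entries \<open>1 + b * u\<close>
      and \<open>1 + b * v\<close> and lower left entry \<open>b\<close>; comparing diagonals forces
      these values. The upper right entry then agrees because the determinant is 1.\<close>
    define u v where "u = (a - 1) / b" and "v = (cnj a - 1) / b"
    have n: "a * cnj a + b * cnj b = 1"
      using arg_cong[OF that(1), of complex_of_real]
      by (simp only: of_real_add complex_norm_square of_real_1)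
    have ub: "b * u = a - 1" and vb: "b * v = cnj a - 1" using that by (simp_all add: u_def v_def)
    have "b * (v + u * cnj a) = b * (- cnj b)" using n ub vb by algebra
    then have *: "v + u * cnj a = - cnj b" using mult_left_cancel[OF that(2)] by blast
    have "su2_act a b = (\<lambda>p. (fst p + u * snd p, snd p)) \<circ> (\<lambda>p. (fst p, snd p + b * fst p)) \<circ>
        (\<lambda>p. (fst p + v * snd p, snd p))" (is "_ = ?S")
    proof
      fix p
      have "fst (?S p) = (1 + b * u) * fst p + (v + u * (1 + b * v)) * snd p"
        by (simp add: algebra_simps)
      moreover have "snd (?S p) = b * fst p + (1 + b * v) * snd p"
        by (simp add: algebra_simps)
      ultimately show "su2_act a b p = ?S p"
        unfolding su2_act_def ub vb by (simp add: prod_eq_iff *)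
    qed
    then show ?thesis
      by (simp only:) (intro preserves_lborel_comp preserves_lborel_shear_fst preserves_lborel_shear_snd)
  qed
  show ?thesis
  proof (cases "b = 0")
    case True
    \<comment> \<open>For \<open>b = 0\<close> the shears would need a division by 0, so the
      diagonal matrix is factored into two antidiagonal ones, to which \<open>nz\<close>
      applies.\<close>
    have "su2_act a 0 = su2_act 0 (- cnj a) \<circ> su2_act 0 1"
      by (auto simp: su2_act_def)
    moreover have "preserves_lborel (su2_act 0 (- cnj a))" "preserves_lborel (su2_act 0 1)"
      using assms True by (auto intro!: nz)
    ultimately show ?thesis using True by (simp add: preserves_lborel_comp)
  qed (use nz assms in blast)
qed

text \<open>Presents conjugation as a real affine map, diagonal in the basis 1, \<i> and with offset
  0, which is the shape that \<open>lborel_affine_euclidean\<close> takes.\<close>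

lemma cnj_eq_sum_Basis:
  fixes c :: "complex \<Rightarrow> real"
  assumes c: "c 1 = 1" "c \<i> = -1"
  shows "cnj = (\<lambda>p. 0 + (\<Sum>j\<in>Basis. (c j * (p \<bullet> j)) *\<^sub>R j))"
proof
  fix p
  have "(\<Sum>j\<in>Basis. (c j * (p \<bullet> j)) *\<^sub>R j) =
      (c 1 * (p \<bullet> 1)) *\<^sub>R 1 + (c \<i> * (p \<bullet> \<i>)) *\<^sub>R \<i>"
    unfolding Basis_complex_def by (subst sum.insert) (auto simp del: scaleR_complex.ctr)
  then show "cnj p = 0 + (\<Sum>j\<in>Basis. (c j * (p \<bullet> j)) *\<^sub>R j)"
    by (simp only: c) (simp add: complex_eq_iff)
qed

lemma preserves_lborel_cnj: "preserves_lborel cnj"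
proof -
  define c :: "complex \<Rightarrow> real" where "c j = (if j = 1 then 1 else -1)" for j
  have T: "cnj = (\<lambda>p. 0 + (\<Sum>j\<in>Basis. (c j * (p \<bullet> j)) *\<^sub>R j))"
    by (rule cnj_eq_sum_Basis) (simp_all add: c_def complex_eq_iff)
  have "lborel = density (distr lborel borel cnj) (\<lambda>_. (\<Prod>j\<in>Basis. \<bar>c j\<bar>))"
    unfolding T by (rule lborel_affine_euclidean) (simp add: c_def)
  also have "(\<Prod>j\<in>Basis. \<bar>c j\<bar>) = 1"
    by (rule prod.neutral) (auto simp: c_def)
  finally have "distr lborel borel cnj = lborel" by (simp add: density_1)
  moreover have "cnj \<in> borel_measurable borel"
    by (intro borel_measurable_continuous_onI continuous_intros)
  ultimately show ?thesis by (simp add: preserves_lborel_def)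
qed

lemma preserves_lborel_uminus: "preserves_lborel (uminus :: 'a::euclidean_space \<Rightarrow> 'a)"
  using lborel_affine[of "-1" "0 :: 'a"] by (simp add: preserves_lborel_def density_1)

text \<open>In the coordinates of the first column this map is inversion on the group, by
  \<open>conj_transpose_su2\<close>.\<close>

lemma preserves_lborel_cnj_uminus:
  "preserves_lborel (\<lambda>p :: complex \<times> complex. (cnj (fst p), - snd p))"
proof -
  have 1: "preserves_lborel (\<lambda>p :: complex \<times> complex. (cnj (fst p), snd p))"
    by (rule preserves_lborel_fibrewise[where T = "\<lambda>y. cnj"])
       (auto intro!: borel_measurable_continuous_onI continuous_intros preserves_lborel_cnj)
  have 2: "preserves_lborel (\<lambda>p :: complex \<times> complex. (- fst p, snd p))"
    by (rule preserves_lborel_fibrewise[where T = "\<lambda>y. uminus"])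
       (auto intro!: borel_measurable_continuous_onI continuous_intros preserves_lborel_uminus)
  have "preserves_lborel ((\<lambda>p. (snd p, fst p)) \<circ> (\<lambda>p :: complex \<times> complex. (- fst p, snd p)) \<circ>
      (\<lambda>p. (snd p, fst p)) \<circ> (\<lambda>p. (cnj (fst p), snd p)))"
    by (intro preserves_lborel_comp preserves_lborel_swap 1 2)
  then show ?thesis by (simp add: comp_def)
qed

section \<open>From Lebesgue measure on the ball to the volume of the group\<close>

lemma emeasure_SU2_vol:
  assumes "A \<in> sets SU2_vol"
  shows "emeasure SU2_vol A = 32 * emeasure lborel
    {p \<in> ball (0 :: complex \<times> complex) 1 - {0}. su2 (fst (sgn p)) (snd (sgn p)) \<in> A}"
proof -
  let ?B = "ball (0 :: complex \<times> complex) 1 - {0}"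
  let ?f = "\<lambda>p :: complex \<times> complex. su2 (fst (sgn p)) (snd (sgn p))"
  have A: "A \<in> sets (restrict_space borel SU2)" using assms by (simp only: sets_SU2_vol)
  have eq: "?f -` A \<inter> space (restrict_space lborel ?B) = {p \<in> ?B. ?f p \<in> A}"
    by (auto simp: space_restrict_space)
  have "emeasure SU2_vol A = 32 * emeasure (restrict_space lborel ?B) {p \<in> ?B. ?f p \<in> A}"
    unfolding SU2_vol_def emeasure_scale_measure emeasure_distr[OF measurable_su2_direction A] eq
    by simp
  also have "emeasure (restrict_space lborel ?B) {p \<in> ?B. ?f p \<in> A} = emeasure lborel {p \<in> ?B. ?f p \<in> A}"
    by (rule emeasure_restrict_space) auto
  finally show ?thesis .
qed

lemma sets_su2_direction:
  assumes "A \<in> sets SU2_vol"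
  shows "{p \<in> ball (0 :: complex \<times> complex) 1 - {0}. su2 (fst (sgn p)) (snd (sgn p)) \<in> A} \<in> sets borel"
proof -
  let ?B = "ball (0 :: complex \<times> complex) 1 - {0}"
  have B: "?B \<inter> space lborel \<in> sets lborel" by simp
  have "{p \<in> ?B. su2 (fst (sgn p)) (snd (sgn p)) \<in> A} =
      (\<lambda>p. su2 (fst (sgn p)) (snd (sgn p))) -` A \<inter> space (restrict_space lborel ?B)"
    by (auto simp: space_restrict_space)
  also have "\<dots> \<in> sets (restrict_space lborel ?B)"
    using assms unfolding sets_SU2_vol by (rule measurable_sets[OF measurable_su2_direction])
  finally show ?thesis unfolding sets_restrict_space_iff[OF B] sets_lborel by (rule conjunct2)
qed

text \<open>Lifts a transformation of the sphere to the ambient space. Since \<open>L\<close>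
  preserves the norm, it maps the punctured ball to itself, and the cone over the preimage of
  \<open>A\<close> under \<open>T\<close> is the preimage under \<open>L\<close> of the cone over
  \<open>A\<close>.\<close>

lemma SU2_vol_distr_eqI:
  assumes L: "preserves_lborel L" and norm: "\<And>p. norm (L p) = norm p"
    and T: "T \<in> measurable (restrict_space borel SU2) (restrict_space borel SU2)"
    and TL: "\<And>p. p \<noteq> 0 \<Longrightarrow> T (su2 (fst (sgn p)) (snd (sgn p))) = su2 (fst (sgn (L p))) (snd (sgn (L p)))"
  shows "distr SU2_vol SU2_vol T = SU2_vol"
proof (rule measure_eqI)
  have T' [measurable]: "T \<in> measurable SU2_vol SU2_vol"
    using T by (simp cong: measurable_cong_sets add: sets_SU2_vol)
  fix A assume "A \<in> sets (distr SU2_vol SU2_vol T)"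
  then have A: "A \<in> sets SU2_vol" by simp
  have TA: "T -` A \<inter> SU2 \<in> sets SU2_vol" using measurable_sets[OF T' A] by simp
  let ?S = "\<lambda>A. {p \<in> ball (0 :: complex \<times> complex) 1 - {0}. su2 (fst (sgn p)) (snd (sgn p)) \<in> A}"
  have "L p = 0 \<longleftrightarrow> p = 0" for p using norm[of p] by (metis norm_eq_zero)
  moreover have "su2 (fst (sgn p)) (snd (sgn p)) \<in> SU2" if "p \<in> ball 0 1 - {0}" for p
    using measurable_space[OF measurable_su2_direction, of p] that by (simp add: space_restrict_space)
  ultimately have "?S (T -` A \<inter> SU2) = L -` ?S A"
    using norm by (auto simp: TL)
  then have "emeasure lborel (?S (T -` A \<inter> SU2)) = emeasure (distr lborel borel L) (?S A)"
    using L sets_su2_direction[OF A] by (subst emeasure_distr) (auto simp: preserves_lborel_def)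
  also have "\<dots> = emeasure lborel (?S A)" using L by (simp add: preserves_lborel_def)
  finally show "emeasure (distr SU2_vol SU2_vol T) A = emeasure SU2_vol A"
    by (simp only: emeasure_distr[OF T' A] space_SU2_vol emeasure_SU2_vol[OF A] emeasure_SU2_vol[OF TA])
qed simp

lemma distr_SU2_vol_mult_left:
  assumes "h \<in> SU2"
  shows "distr SU2_vol SU2_vol (\<lambda>x. h ** x) = SU2_vol"
proof -
  obtain a b where h: "h = su2 a b" and ab: "(cmod a)\<^sup>2 + (cmod b)\<^sup>2 = 1"
    using assms by (auto simp: SU2_def)
  have norm: "norm (su2_act a b p) = norm p" for p
  proof -
    have "complex_of_real ((cmod (a * fst p - cnj b * snd p))\<^sup>2 + (cmod (b * fst p + cnj a * snd p))\<^sup>2) =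
      complex_of_real (((cmod a)\<^sup>2 + (cmod b)\<^sup>2) * ((cmod (fst p))\<^sup>2 + (cmod (snd p))\<^sup>2))"
      unfolding of_real_add of_real_mult complex_norm_square by (simp add: algebra_simps)
    then show ?thesis
      unfolding of_real_eq_iff ab by (simp add: norm_prod_def su2_act_def)
  qed
  have sgn: "sgn (su2_act a b p) = su2_act a b (sgn p)" for p
    unfolding sgn_div_norm norm
    by (simp add: su2_act_def prod_eq_iff scaleR_right_diff_distrib scaleR_right_distrib)
  show ?thesis
    by (rule SU2_vol_distr_eqI[OF preserves_lborel_su2_act[OF ab] norm measurable_SU2_mult_left[OF assms]])
       (simp add: h su2_mult sgn, simp add: su2_act_def)
qed

lemma distr_SU2_vol_conj_transpose: "distr SU2_vol SU2_vol conj_transpose = SU2_vol"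
proof (rule SU2_vol_distr_eqI[OF preserves_lborel_cnj_uminus])
  have norm: "norm (cnj (fst p), - snd p) = norm p" for p :: "complex \<times> complex"
    by (simp add: norm_prod_def)
  then show "norm (cnj (fst p), - snd p) = norm p" for p :: "complex \<times> complex" .
  show "conj_transpose (su2 (fst (sgn p)) (snd (sgn p))) =
      su2 (fst (sgn (cnj (fst p), - snd p))) (snd (sgn (cnj (fst p), - snd p)))" for p
    unfolding sgn_div_norm norm by (simp add: conj_transpose_su2)
qed (rule measurable_SU2_conj_transpose)

text \<open>Inversion turns right multiplication into left multiplication by the inverse, so
  invariance under inversion and under left multiplication suffices.\<close>

lemma distr_SU2_vol_mult_right:
  assumes "h \<in> SU2"
  shows "distr SU2_vol SU2_vol (\<lambda>x. x ** h) = SU2_vol"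
proof -
  let ?h = "conj_transpose h"
  have [measurable]: "conj_transpose \<in> measurable SU2_vol SU2_vol"
    "(\<lambda>x. ?h ** x) \<in> measurable SU2_vol SU2_vol"
    using measurable_SU2_conj_transpose measurable_SU2_mult_left[OF SU2_conj_transpose[OF assms]]
    by (simp_all cong: measurable_cong_sets add: sets_SU2_vol)
  have "(\<lambda>x. x ** h) = conj_transpose \<circ> ((\<lambda>x. ?h ** x) \<circ> conj_transpose)"
    by (auto simp: conj_transpose_mult)
  then have "distr SU2_vol SU2_vol (\<lambda>x. x ** h) =
      distr (distr (distr SU2_vol SU2_vol conj_transpose) SU2_vol (\<lambda>x. ?h ** x)) SU2_vol conj_transpose"
    by (subst distr_distr, measurable)+ (simp add: comp_def conj_transpose_mult)
  then show ?thesis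
    by (simp add: distr_SU2_vol_conj_transpose distr_SU2_vol_mult_left SU2_conj_transpose assms)
qed

section \<open>Fourier analysis of \<open>\<int>/N\<close> and Bernstein averages\<close>

definition dft_char :: "nat \<Rightarrow> nat \<Rightarrow> nat \<Rightarrow> complex" where
  "dft_char N j k = cis (2 * pi * real j * real k / real N)"

lemma dft_char_power: "dft_char N j 1 ^ k = dft_char N j k"
  unfolding dft_char_def Complex.DeMoivre by (rule arg_cong[where f = cis]) (simp add: field_simps)

lemma norm_dft_char [simp]: "cmod (dft_char N j k) = 1"
  by (simp add: dft_char_def)

text \<open>All summands are powers of one root of unity \<open>q\<close> with
  \<open>q ^ N = 1\<close>, so this is a geometric sum. The roots of unity with exponents below
  \<open>N\<close> are distinct, so \<open>q = 1\<close> only for \<open>k = k'\<close>.\<close>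

lemma dft_char_orthogonal:
  assumes "k < N" "k' < N"
  shows "(\<Sum>j<N. dft_char N j k * cnj (dft_char N j k')) = (if k = k' then of_nat N else 0)"
proof -
  define q where "q = cis (2 * pi * real k / real N) * cnj (cis (2 * pi * real k' / real N))"
  have N: "real N > 0" using assms by simp
  have tm: "dft_char N j k * cnj (dft_char N j k') = q ^ j" for j
    unfolding q_def dft_char_def power_mult_distrib complex_cnj_power[symmetric] Complex.DeMoivre
    by (intro arg_cong2[where f = "(*)"] arg_cong[where f = cnj] arg_cong[where f = cis])
      (simp_all add: field_simps)
  have qN: "q ^ N = 1"
    unfolding q_def power_mult_distrib complex_cnj_power[symmetric] Complex.DeMoivre
    using N by (simp add: cis_multiple_2pi)
  have "q = 1 \<longleftrightarrow> k = k'"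
  proof
    assume "q = 1"
    then have "q * cis (2 * pi * real k' / real N) = cis (2 * pi * real k' / real N)" by simp
    moreover have "q * cis (2 * pi * real k' / real N) = cis (2 * pi * real k / real N)"
      by (simp add: q_def mult.assoc cis_cnj cis_mult)
    moreover have "inj_on (\<lambda>k. cis (2 * pi * real k / real N)) {..<N}"
      using Complex.bij_betw_roots_unity[of N] assms by (simp add: bij_betw_def)
    ultimately show "k = k'" using assms by (auto dest!: inj_onD)
  qed (simp add: q_def cis_cnj cis_mult)
  then show ?thesis unfolding tm by (auto simp: sum_gp_strict qN)
qed

text \<open>Recovers a coefficient of a polynomial of degree at most \<open>n\<close> from its
  values at the roots of unity of order \<open>n + 1\<close>; this yields an explicit formula for
  \<open>wigner_D\<close>.\<close>

lemma dft_coefficient: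
  assumes "k \<le> n"
  shows "(\<Sum>j<Suc n. cnj (dft_char (Suc n) j k) * (\<Sum>i\<le>n. e i * dft_char (Suc n) j 1 ^ i)) =
    of_nat (Suc n) * e k"
proof -
  let ?E = "dft_char (Suc n)"
  have "(\<Sum>j<Suc n. cnj (?E j k) * (\<Sum>i\<le>n. e i * ?E j 1 ^ i)) =
      (\<Sum>i\<le>n. e i * (\<Sum>j<Suc n. ?E j i * cnj (?E j k)))"
    unfolding dft_char_power sum_distrib_left by (subst sum.swap) (simp only: mult_ac)
  also have "\<dots> = (\<Sum>i\<le>n. if i = k then of_nat (Suc n) * e k else 0)"
    by (rule sum.cong) (use assms in \<open>auto simp: dft_char_orthogonal simp del: sum.lessThan_Suc of_nat_Suc\<close>)
  finally show ?thesis using assms by simp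
qed

text \<open>This is the removal of the cross terms, as a finite sum over phases in place of an
  integral over the circle. Distinct indices up to \<open>n\<close> stay distinct modulo
  \<open>n + 1\<close>, hence the order \<open>Suc n\<close>.\<close>

lemma dft_parseval:
  "(\<Sum>j<Suc n. (cmod (\<Sum>k\<le>n. dft_char (Suc n) j k * b k))\<^sup>2) = real (Suc n) * (\<Sum>k\<le>n. (cmod (b k))\<^sup>2)"
proof -
  let ?E = "dft_char (Suc n)"
  have "complex_of_real (\<Sum>j<Suc n. (cmod (\<Sum>k\<le>n. ?E j k * b k))\<^sup>2) =
      (\<Sum>j<Suc n. (\<Sum>k\<le>n. ?E j k * b k) * (\<Sum>k'\<le>n. cnj (?E j k') * cnj (b k')))"
    by (simp only: of_real_sum complex_norm_square cnj_sum complex_cnj_mult)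
  also have "\<dots> = (\<Sum>j<Suc n. \<Sum>k\<le>n. \<Sum>k'\<le>n. b k * cnj (b k') * (?E j k * cnj (?E j k')))"
    unfolding sum_product by (simp only: mult_ac)
  also have "\<dots> = (\<Sum>k\<le>n. \<Sum>j<Suc n. \<Sum>k'\<le>n. b k * cnj (b k') * (?E j k * cnj (?E j k')))"
    by (rule sum.swap)
  also have "\<dots> = (\<Sum>k\<le>n. \<Sum>k'\<le>n. b k * cnj (b k') * (\<Sum>j<Suc n. ?E j k * cnj (?E j k')))"
    unfolding sum_distrib_left by (rule sum.cong[OF refl], rule sum.swap)
  also have "\<dots> = (\<Sum>k\<le>n. \<Sum>k'\<le>n. if k' = k then b k * cnj (b k) * of_nat (Suc n) else 0)"
    by (intro sum.cong refl) (auto simp: dft_char_orthogonal simp del: sum.lessThan_Suc of_nat_Suc)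
  also have "\<dots> = (\<Sum>k\<le>n. b k * cnj (b k) * of_nat (Suc n))"
    by (intro sum.cong refl) (simp add: sum.delta)
  also have "\<dots> = complex_of_real (real (Suc n) * (\<Sum>k\<le>n. (cmod (b k))\<^sup>2))"
    by (simp only: of_real_sum of_real_mult of_real_of_nat_eq complex_norm_square sum_distrib_left mult.commute)
  finally show ?thesis unfolding of_real_eq_iff .
qed

text \<open>The weights sum to 1, so subtracting \<open>c 0\<close> gives a Bernstein sum that
  vanishes. In the variable \<open>t / (1 - t)\<close> it is, up to the factor
  \<open>(1 - t) ^ n\<close>, an ordinary polynomial with all positive numbers as roots, so all its
  coefficients vanish.\<close>

lemma bernstein_average_const:
  fixes c :: "nat \<Rightarrow> real"
  assumes c: "\<And>t. 0 < t \<Longrightarrow> t < 1 \<Longrightarrow> (\<Sum>k\<le>n. real (n choose k) * t ^ k * (1 - t) ^ (n - k) * c k) = c 0"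
    and k: "k \<le> n"
  shows "c k = c 0"
proof (rule ccontr)
  define d where "d k = real (n choose k) * (c k - c 0)" for k
  assume "c k \<noteq> c 0"
  then have "d k \<noteq> 0" using k by (simp add: d_def)
  then have "finite {x. (\<Sum>i\<le>n. d i * x ^ i) = 0}"
    using k by (rule polyfun_roots_finite)
  moreover have "{0<..} \<subseteq> {x. (\<Sum>i\<le>n. d i * x ^ i) = 0}"
  proof (rule subsetI, rule CollectI)
    fix x :: real assume x: "x \<in> {0<..}"
    \<comment> \<open>Inverse of the substitution \<open>x = t / (1 - t)\<close>.\<close>
    define t where "t = x / (1 + x)"
    have t: "0 < t" "t < 1" "1 - t = 1 / (1 + x)" using x by (simp_all add: t_def field_simps)
    have "(\<Sum>i\<le>n. d i * x ^ i) = (1 + x) ^ n * (\<Sum>i\<le>n. real (n choose i) * t ^ i * (1 - t) ^ (n - i) * (c i - c 0))"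
      unfolding sum_distrib_left
    proof (rule sum.cong)
      fix i assume "i \<in> {..n}"
      then have 1: "(1 + x) ^ n = (1 + x) ^ i * (1 + x) ^ (n - i)" by (simp flip: power_add)
      have 2: "(1 + x) ^ i * t ^ i = x ^ i"
        using x by (simp add: t_def flip: power_mult_distrib)
      have 3: "(1 + x) ^ (n - i) * (1 - t) ^ (n - i) = 1"
        using x by (simp add: t(3) flip: power_mult_distrib)
      have "(1 + x) ^ n * (real (n choose i) * t ^ i * (1 - t) ^ (n - i) * (c i - c 0)) =
          real (n choose i) * (c i - c 0) * ((1 + x) ^ i * t ^ i) * ((1 + x) ^ (n - i) * (1 - t) ^ (n - i))"
        unfolding 1 by (simp only: mult_ac)
      then show "d i * x ^ i = (1 + x) ^ n * (real (n choose i) * t ^ i * (1 - t) ^ (n - i) * (c i - c 0))"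
        unfolding 2 3 d_def by (simp only: mult_ac mult_1_left)
    qed simp
    also have "(\<Sum>i\<le>n. real (n choose i) * t ^ i * (1 - t) ^ (n - i) * (c i - c 0)) =
        c 0 - (\<Sum>i\<le>n. real (n choose i) * t ^ i * (1 - t) ^ (n - i)) * c 0"
      using c[OF t(1,2)] by (simp add: right_diff_distrib sum_subtractf sum_distrib_right)
    also have "(\<Sum>i\<le>n. real (n choose i) * t ^ i * (1 - t) ^ (n - i)) = 1"
      using binomial_ring[of t "1 - t" n] by simp
    finally show "(\<Sum>i\<le>n. d i * x ^ i) = 0" by simp
  qed
  moreover have "infinite {0::real<..}" by (rule infinite_Ioi)
  ultimately show False using finite_subset by blast
qed

text \<open>The vector of coefficients is kept abstract here, and so is the weight \<open>w\<close>;
  left and right invariance, weak and strong, are the four uses. No relation between the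
  \<open>b k\<close> for different \<open>k\<close> enters except through
  \<open>inv\<close>.\<close>

lemma weighted_second_moments_equal:
  fixes w :: "'w \<Rightarrow> ennreal" and b :: "nat \<Rightarrow> 'w \<Rightarrow> complex"
  assumes w [measurable]: "w \<in> borel_measurable M"
    and b [measurable]: "\<And>k. k \<le> n \<Longrightarrow> b k \<in> borel_measurable M"
    and fin: "\<And>k. k \<le> n \<Longrightarrow> (\<integral>\<^sup>+\<omega>. ennreal ((cmod (b k \<omega>))\<^sup>2) * w \<omega> \<partial>M) < \<infinity>"
    and inv: "\<And>\<alpha> \<beta>. (cmod \<alpha>)\<^sup>2 + (cmod \<beta>)\<^sup>2 = 1 \<Longrightarrow>
      (\<integral>\<^sup>+\<omega>. ennreal ((cmod (\<Sum>k\<le>n. complex_of_real (sqrt (real (n choose k))) * \<beta> ^ k * \<alpha> ^ (n - k) * b k \<omega>))\<^sup>2)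
        * w \<omega> \<partial>M) = (\<integral>\<^sup>+\<omega>. ennreal ((cmod (b 0 \<omega>))\<^sup>2) * w \<omega> \<partial>M)"
    and k: "k \<le> n"
  shows "(\<integral>\<^sup>+\<omega>. ennreal ((cmod (b k \<omega>))\<^sup>2) * w \<omega> \<partial>M) = (\<integral>\<^sup>+\<omega>. ennreal ((cmod (b 0 \<omega>))\<^sup>2) * w \<omega> \<partial>M)"
proof -
  define R where "R k = (\<integral>\<^sup>+\<omega>. ennreal ((cmod (b k \<omega>))\<^sup>2) * w \<omega> \<partial>M)" for k
  \<comment> \<open>The Bernstein argument subtracts, so it needs real numbers; finiteness of the
    moments makes the conversion faithful.\<close>
  define c where "c k = enn2real (R k)" for k
  have Rc: "R k = ennreal (c k)" if "k \<le> n" for k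
    using fin[OF that] by (simp add: R_def c_def less_top)
  have c0: "0 \<le> c k" for k by (simp add: c_def)
  have "c k = c 0"
  proof (rule bernstein_average_const[OF _ k])
    fix t :: real assume t: "0 < t" "t < 1"
    let ?E = "dft_char (Suc n)"
    \<comment> \<open>The amplitudes for \<open>\<alpha> = sqrt (1 - t)\<close> and
      \<open>\<beta> = sqrt t\<close> times a root of unity; the phase of \<open>\<beta>\<close>
      contributes \<open>?E j k\<close> to the \<open>k\<close>-th term.\<close>
    define a where "a k = complex_of_real (sqrt (real (n choose k)) * sqrt t ^ k * sqrt (1 - t) ^ (n - k))" for k
    have a: "(cmod (a k))\<^sup>2 = real (n choose k) * t ^ k * (1 - t) ^ (n - k)" for k
      using t by (simp add: a_def norm_mult norm_power power_mult_distrib flip: power_mult)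
        (simp add: power_mult mult.commute[of _ 2])
    \<comment> \<open>Each of the \<open>Suc n\<close> phases gives a group element and hence the
      same value \<open>R 0\<close>. The sum over phases is kept undivided.\<close>
    have "ennreal (real (Suc n)) * R 0 = (\<Sum>j<Suc n. R 0)" by (simp add: ennreal_of_nat_eq_real_of_nat)
    also have "\<dots> = (\<Sum>j<Suc n. \<integral>\<^sup>+\<omega>. ennreal ((cmod (\<Sum>k\<le>n. ?E j k * (a k * b k \<omega>)))\<^sup>2) * w \<omega> \<partial>M)"
    proof (rule sum.cong)
      fix j
      let ?\<alpha> = "complex_of_real (sqrt (1 - t))" and ?\<beta> = "complex_of_real (sqrt t) * ?E j 1"
      have "(cmod ?\<alpha>)\<^sup>2 + (cmod ?\<beta>)\<^sup>2 = 1" using t by (simp add: norm_mult)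
      from inv[OF this] show "R 0 = (\<integral>\<^sup>+\<omega>. ennreal ((cmod (\<Sum>k\<le>n. ?E j k * (a k * b k \<omega>)))\<^sup>2) * w \<omega> \<partial>M)"
        unfolding R_def power_mult_distrib dft_char_power a_def of_real_mult of_real_power
        by (simp only: mult_ac)
    qed simp
    also have "\<dots> = (\<integral>\<^sup>+\<omega>. (\<Sum>j<Suc n. ennreal ((cmod (\<Sum>k\<le>n. ?E j k * (a k * b k \<omega>)))\<^sup>2) * w \<omega>) \<partial>M)"
      by (rule nn_integral_sum[symmetric]) measurable
    also have "\<dots> = (\<integral>\<^sup>+\<omega>. (\<Sum>k\<le>n. ennreal (real (Suc n) * (real (n choose k) * t ^ k * (1 - t) ^ (n - k))) *
        (ennreal ((cmod (b k \<omega>))\<^sup>2) * w \<omega>)) \<partial>M)"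
    proof (rule nn_integral_cong)
      fix \<omega>
      have "(\<Sum>j<Suc n. ennreal ((cmod (\<Sum>k\<le>n. ?E j k * (a k * b k \<omega>)))\<^sup>2) * w \<omega>) =
          ennreal (\<Sum>j<Suc n. (cmod (\<Sum>k\<le>n. ?E j k * (a k * b k \<omega>)))\<^sup>2) * w \<omega>"
        unfolding sum_distrib_right[symmetric] by (subst sum_ennreal) auto
      also have "\<dots> = ennreal (\<Sum>k\<le>n. real (Suc n) * (real (n choose k) * t ^ k * (1 - t) ^ (n - k)) * (cmod (b k \<omega>))\<^sup>2) * w \<omega>"
        unfolding dft_parseval norm_mult power_mult_distrib a sum_distrib_left by (simp only: mult_ac)
      also have "\<dots> = (\<Sum>k\<le>n. ennreal (real (Suc n) * (real (n choose k) * t ^ k * (1 - t) ^ (n - k)) * (cmod (b k \<omega>))\<^sup>2)) * w \<omega>"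
        using t by (subst sum_ennreal) auto
      also have "\<dots> = (\<Sum>k\<le>n. ennreal (real (Suc n) * (real (n choose k) * t ^ k * (1 - t) ^ (n - k))) *
        (ennreal ((cmod (b k \<omega>))\<^sup>2) * w \<omega>))"
        unfolding sum_distrib_right using t by (intro sum.cong refl) (simp add: ennreal_mult mult.assoc)
      finally show "(\<Sum>j<Suc n. ennreal ((cmod (\<Sum>k\<le>n. ?E j k * (a k * b k \<omega>)))\<^sup>2) * w \<omega>) = \<dots>" .
    qed
    also have "\<dots> = (\<Sum>k\<le>n. ennreal (real (Suc n) * (real (n choose k) * t ^ k * (1 - t) ^ (n - k))) * R k)"
      unfolding R_def by (subst nn_integral_sum) (auto intro!: sum.cong nn_integral_cmult)
    also have "\<dots> = ennreal (real (Suc n) * (\<Sum>k\<le>n. real (n choose k) * t ^ k * (1 - t) ^ (n - k) * c k))"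
      unfolding sum_distrib_left using t c0
      by (subst sum_ennreal[symmetric])
        (auto intro!: sum.cong mult_nonneg_nonneg simp: Rc mult.assoc simp flip: ennreal_mult)
    finally have "ennreal (real (Suc n) * c 0) =
        ennreal (real (Suc n) * (\<Sum>k\<le>n. real (n choose k) * t ^ k * (1 - t) ^ (n - k) * c k))"
      using c0 by (simp add: Rc ennreal_mult del: of_nat_Suc)
    then have "real (Suc n) * c 0 = real (Suc n) * (\<Sum>k\<le>n. real (n choose k) * t ^ k * (1 - t) ^ (n - k) * c k)"
      using t c0 by (subst (asm) ennreal_inj) (auto intro!: mult_nonneg_nonneg sum_nonneg simp del: of_nat_Suc)
    then show "(\<Sum>k\<le>n. real (n choose k) * t ^ k * (1 - t) ^ (n - k) * c k) = c 0"
      by (simp del: of_nat_Suc)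
  qed
  then have "R k = R 0" using Rc k by simp
  then show ?thesis by (simp only: R_def)
qed

section \<open>Wigner functions and coefficients\<close>

lemma sum_weights:
  assumes "2 * l = real n"
  shows "(\<Sum>m\<in>weights l. f m) = (\<Sum>k\<le>n. f (- l + real k))"
  unfolding weights_eq_image[OF assms] by (subst sum.reindex) (auto simp: inj_on_def)

lemma half_nats_E:
  assumes "l \<in> half_nats"
  obtains n where "2 * l = real n"
  using assms by (auto simp: half_nats_def Nats_def)

lemma wigner_psi_eq:
  assumes "2 * l = real n" "k \<le> n"
  shows "wigner_psi l (- l + real k) x y =
    complex_of_real (sqrt (real (n choose k))) * x ^ k * y ^ (n - k)"
proof -
  have "l - (- l + real k) = real (n - k)" using assms by (simp add: of_nat_diff)
  then show ?thesis using assms(1) by (simp add: wigner_psi_def del: of_nat_diff)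
qed

lemma lowest_weight: "l \<in> half_nats \<Longrightarrow> - l \<in> weights l"
  by (erule half_nats_E) (auto simp: weights_def intro!: exI[of _ 0])

text \<open>The way to compute an entry of the definite description: exhibit coefficients that
  satisfy the defining identity.\<close>

lemma wigner_D_unique:
  assumes "l \<in> half_nats" "s \<in> weights l" "m \<in> weights l"
    and c: "\<And>z0 z1. (\<Sum>m\<in>weights l. wigner_psi l m z0 z1 * c m) =
      wigner_psi l s (cnj \<alpha> * z0 + cnj \<beta> * z1) (- \<beta> * z0 + \<alpha> * z1)"
  shows "wigner_D l m s (su2 \<alpha> \<beta>) = c m"
proof -
  \<comment> \<open>The definition asks for coefficients that vanish off \<open>weights l\<close>,
    whereas \<open>c\<close> is arbitrary there.\<close>
  let ?c = "\<lambda>m. if m \<in> weights l then c m else 0"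
  have "(\<Sum>m\<in>weights l. wigner_psi l m z0 z1 * ?c m) =
      wigner_psi l s (cnj \<alpha> * z0 + cnj \<beta> * z1) (- \<beta> * z0 + \<alpha> * z1)" for z0 z1
    unfolding c[symmetric] by (rule sum.cong) auto
  then have "(THE c. (\<forall>m. m \<notin> weights l \<longrightarrow> c m = 0) \<and>
      (\<forall>z0 z1. (\<Sum>m\<in>weights l. wigner_psi l m z0 z1 * c m) =
         wigner_psi l s (cnj \<alpha> * z0 + cnj \<beta> * z1) (- \<beta> * z0 + \<alpha> * z1))) = ?c"
    by (intro the1_equality wigner_D_ex1[OF assms(1,2)]) auto
  then show ?thesis using assms(3) by (simp add: wigner_D_def)
qed

text \<open>The defining identity describes a linear substitution in the variables of a form.
  Substituting for \<open>h\<close> after \<open>g\<close> is the substitution for the product, and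
  comparing coefficients gives the matrix product.\<close>

lemma wigner_D_mult:
  assumes l: "l \<in> half_nats" and s: "s \<in> weights l" and m: "m \<in> weights l"
    and g: "g \<in> SU2" and h: "h \<in> SU2"
  shows "wigner_D l m s (g ** h) = (\<Sum>k\<in>weights l. wigner_D l m k g * wigner_D l k s h)"
proof -
  obtain a b c d where gh: "g = su2 a b" "h = su2 c d"
    using g h by (auto simp: SU2_def)
  show ?thesis
    unfolding gh su2_mult
  proof (rule wigner_D_unique[OF l s m])
    fix z0 z1
    define w0 w1 where "w0 = cnj a * z0 + cnj b * z1" and "w1 = - b * z0 + a * z1"
    have "(\<Sum>m\<in>weights l. wigner_psi l m z0 z1 *
          (\<Sum>k\<in>weights l. wigner_D l m k (su2 a b) * wigner_D l k s (su2 c d))) =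
        (\<Sum>k\<in>weights l. (\<Sum>m\<in>weights l. wigner_psi l m z0 z1 * wigner_D l m k (su2 a b)) *
          wigner_D l k s (su2 c d))"
      unfolding sum_distrib_left sum_distrib_right by (subst sum.swap) (simp add: mult.assoc)
    also have "\<dots> = (\<Sum>k\<in>weights l. wigner_psi l k w0 w1 * wigner_D l k s (su2 c d))"
      unfolding w0_def w1_def by (intro sum.cong refl arg_cong2[where f = "(*)"] wigner_D_eq l)
    also have "\<dots> = wigner_psi l s (cnj c * w0 + cnj d * w1) (- d * w0 + c * w1)"
      by (rule wigner_D_eq[OF l s])
    also have "cnj c * w0 + cnj d * w1 =
        cnj (a * c - cnj b * d) * z0 + cnj (b * c + cnj a * d) * z1"
      by (simp add: w0_def w1_def algebra_simps)
    also have "- d * w0 + c * w1 = - (b * c + cnj a * d) * z0 + (a * c - cnj b * d) * z1"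
      by (simp add: w0_def w1_def algebra_simps)
    finally show "(\<Sum>m\<in>weights l. wigner_psi l m z0 z1 *
          (\<Sum>k\<in>weights l. wigner_D l m k (su2 a b) * wigner_D l k s (su2 c d))) =
        wigner_psi l s (cnj (a * c - cnj b * d) * z0 + cnj (b * c + cnj a * d) * z1)
          (- (b * c + cnj a * d) * z0 + (a * c - cnj b * d) * z1)" .
  qed
qed

text \<open>At the point \<open>(0, 1)\<close> every \<open>wigner_psi\<close> vanishes except the
  one of lowest weight, where \<open>0 ^ 0 = 1\<close>, so the defining identity reduces to one
  entry.\<close>

lemma wigner_D_lowest_row:
  assumes l: "l \<in> half_nats" and s: "s \<in> weights l"
  shows "wigner_D l (- l) s (su2 \<alpha> \<beta>) = wigner_psi l s (cnj \<beta>) \<alpha>"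
proof -
  obtain n where n: "2 * l = real n" using l by (rule half_nats_E)
  have "(\<Sum>m\<in>weights l. wigner_psi l m 0 1 * wigner_D l m s (su2 \<alpha> \<beta>)) =
      (\<Sum>k\<le>n. if k = 0 then wigner_D l (- l + real k) s (su2 \<alpha> \<beta>) else 0)"
    unfolding sum_weights[OF n]
  proof (rule sum.cong)
    fix k assume "k \<in> {..n}"
    then have k: "k \<le> n" by simp
    show "wigner_psi l (- l + real k) 0 1 * wigner_D l (- l + real k) s (su2 \<alpha> \<beta>) =
        (if k = 0 then wigner_D l (- l + real k) s (su2 \<alpha> \<beta>) else 0)"
      unfolding wigner_psi_eq[OF n k] by simp
  qed simp
  then show ?thesis
    using wigner_D_eq[OF assms, of 0 1 \<alpha> \<beta>] by (simp add: sum.delta)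
qed

text \<open>For \<open>s = - l\<close> the right-hand side of the defining identity is the
  \<open>n\<close>-th power of a linear form. In its binomial expansion each binomial coefficient
  splits into two square roots, one for each \<open>wigner_psi\<close>.\<close>

lemma wigner_D_lowest_column:
  assumes l: "l \<in> half_nats" and m: "m \<in> weights l"
  shows "wigner_D l m (- l) (su2 \<alpha> \<beta>) = wigner_psi l m (- \<beta>) \<alpha>"
proof (rule wigner_D_unique[OF l lowest_weight[OF l] m])
  fix z0 z1
  obtain n where n: "2 * l = real n" using l by (rule half_nats_E)
  have sq: "complex_of_real (sqrt (real (n choose k))) * complex_of_real (sqrt (real (n choose k))) =
      of_nat (n choose k)" for k
    by (simp flip: of_real_mult)
  have "(\<Sum>m\<in>weights l. wigner_psi l m z0 z1 * wigner_psi l m (- \<beta>) \<alpha>) =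
      (\<Sum>k\<le>n. of_nat (n choose k) * (- \<beta> * z0) ^ k * (\<alpha> * z1) ^ (n - k))"
    unfolding sum_weights[OF n]
  proof (rule sum.cong)
    fix k assume "k \<in> {..n}"
    then have k: "k \<le> n" by simp
    show "wigner_psi l (- l + real k) z0 z1 * wigner_psi l (- l + real k) (- \<beta>) \<alpha> =
        of_nat (n choose k) * (- \<beta> * z0) ^ k * (\<alpha> * z1) ^ (n - k)"
      unfolding wigner_psi_eq[OF n k] sq[symmetric] power_mult_distrib by (simp only: mult_ac)
  qed simp
  also have "\<dots> = (- \<beta> * z0 + \<alpha> * z1) ^ n" by (rule binomial_ring[symmetric])
  also have "\<dots> = wigner_psi l (- l) (cnj \<alpha> * z0 + cnj \<beta> * z1) (- \<beta> * z0 + \<alpha> * z1)"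
    using wigner_psi_eq[OF n, of 0] by simp
  finally show "(\<Sum>m\<in>weights l. wigner_psi l m z0 z1 * wigner_psi l m (- \<beta>) \<alpha>) =
      wigner_psi l (- l) (cnj \<alpha> * z0 + cnj \<beta> * z1) (- \<beta> * z0 + \<alpha> * z1)" .
qed

text \<open>The defining identity at \<open>z1 = 1\<close> is a polynomial in \<open>z0\<close>,
  whose coefficients are read off from its values at roots of unity. In contrast to the definite
  description, the result visibly depends continuously on the group element, which gives
  measurability and boundedness.\<close>

lemma wigner_D_dft:
  assumes n: "2 * l = real n" and s: "s \<in> weights l" and k: "k \<le> n"
  shows "wigner_D l (- l + real k) s (su2 \<alpha> \<beta>) =
    (\<Sum>j<Suc n. cnj (dft_char (Suc n) j k) *
       wigner_psi l s (cnj \<alpha> * dft_char (Suc n) j 1 + cnj \<beta>) (- \<beta> * dft_char (Suc n) j 1 + \<alpha>)) /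
    (of_nat (Suc n) * complex_of_real (sqrt (real (n choose k))))"
proof -
  let ?E = "dft_char (Suc n)"
  let ?D = "\<lambda>i. wigner_D l (- l + real i) s (su2 \<alpha> \<beta>)"
  let ?B = "\<lambda>i. complex_of_real (sqrt (real (n choose i)))"
  have l: "l \<in> half_nats" using n by (auto simp: half_nats_def)
  have "wigner_psi l s (cnj \<alpha> * x + cnj \<beta>) (- \<beta> * x + \<alpha>) = (\<Sum>i\<le>n. (?B i * ?D i) * x ^ i)" for x
  proof -
    have "wigner_psi l s (cnj \<alpha> * x + cnj \<beta> * 1) (- \<beta> * x + \<alpha> * 1) =
        (\<Sum>i\<le>n. wigner_psi l (- l + real i) x 1 * ?D i)"
      unfolding wigner_D_eq[OF l s, symmetric] sum_weights[OF n] ..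
    also have "\<dots> = (\<Sum>i\<le>n. (?B i * ?D i) * x ^ i)"
      by (rule sum.cong) (simp_all only: atMost_iff wigner_psi_eq[OF n] power_one mult_1_left mult_1_right mult_ac)
    finally show ?thesis by simp
  qed
  then have "(\<Sum>j<Suc n. cnj (?E j k) * wigner_psi l s (cnj \<alpha> * ?E j 1 + cnj \<beta>) (- \<beta> * ?E j 1 + \<alpha>)) =
      of_nat (Suc n) * (?B k * ?D k)"
    using dft_coefficient[OF k, of "\<lambda>i. ?B i * ?D i"] by (simp only:)
  moreover have "of_nat (Suc n) * ?B k \<noteq> 0" using k by (simp del: of_nat_Suc)
  ultimately show ?thesis by (simp only: mult.assoc[symmetric] nonzero_mult_div_cancel_left not_False_eq_True)
qed

lemma SU2_eq_su2: "g \<in> SU2 \<Longrightarrow> g = su2 (g $ 1 $ 1) (g $ 2 $ 1)"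
  by (auto simp: SU2_def)

lemma SU2_norm_entries:
  assumes "g \<in> SU2"
  shows "cmod (g $ 1 $ 1) \<le> 1" "cmod (g $ 2 $ 1) \<le> 1"
proof -
  have "(cmod (g $ 1 $ 1))\<^sup>2 + (cmod (g $ 2 $ 1))\<^sup>2 = 1" using assms by (auto simp: SU2_def)
  then have "(cmod (g $ 1 $ 1))\<^sup>2 \<le> 1" "(cmod (g $ 2 $ 1))\<^sup>2 \<le> 1"
    by (smt (verit) zero_le_power2)+
  then show "cmod (g $ 1 $ 1) \<le> 1" "cmod (g $ 2 $ 1) \<le> 1" by (simp_all add: abs_square_le_1)
qed

lemma wigner_D_measurable:
  assumes l: "l \<in> half_nats" and m: "m \<in> weights l" and s: "s \<in> weights l"
  shows "wigner_D l m s \<in> borel_measurable (restrict_space borel SU2)"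
proof -
  obtain n where n: "2 * l = real n" using l by (rule half_nats_E)
  obtain k where k: "m = - l + real k" "k \<le> n" using m n by (auto simp: weights_def)
  let ?E = "dft_char (Suc n)"
  let ?F = "\<lambda>g :: complex^2^2. (\<Sum>j<Suc n. cnj (?E j k) *
       wigner_psi l s (cnj (g$1$1) * ?E j 1 + cnj (g$2$1)) (- (g$2$1) * ?E j 1 + g$1$1)) /
    (of_nat (Suc n) * complex_of_real (sqrt (real (n choose k))))"
  have "continuous_on SU2 ?F"
    unfolding wigner_psi_def using k(2)
    by (intro continuous_intros) (auto simp del: of_nat_Suc)
  then have "?F \<in> borel_measurable (restrict_space borel SU2)"
    by (rule borel_measurable_continuous_on_restrict)
  moreover have "wigner_D l m s g = ?F g" if "g \<in> SU2" for g
    by (subst SU2_eq_su2[OF that]) (simp only: k(1) wigner_D_dft[OF n s k(2)])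
  ultimately show ?thesis
    by (subst measurable_cong[where g = ?F]) (auto simp: space_restrict_space)
qed

lemma wigner_D_bounded:
  assumes l: "l \<in> half_nats" and m: "m \<in> weights l" and s: "s \<in> weights l"
  shows "\<exists>B. \<forall>g\<in>SU2. cmod (wigner_D l m s g) \<le> B"
proof -
  obtain n where n: "2 * l = real n" using l by (rule half_nats_E)
  obtain k where k: "m = - l + real k" "k \<le> n" using m n by (auto simp: weights_def)
  let ?E = "dft_char (Suc n)"
  \<comment> \<open>In \<open>wigner_D_dft\<close> both arguments of \<open>wigner_psi\<close> are
    sums of two numbers of modulus at most 1, hence the powers of 2.\<close>
  define C where "C = sqrt (real (nat \<lfloor>2 * l\<rfloor> choose nat \<lfloor>l + s\<rfloor>)) * 2 ^ nat \<lfloor>l + s\<rfloor> * 2 ^ nat \<lfloor>l - s\<rfloor>"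
  have C: "cmod (wigner_psi l s x y) \<le> C" if "cmod x \<le> 2" "cmod y \<le> 2" for x y
    unfolding wigner_psi_def C_def norm_mult norm_power using that
    by (intro mult_mono power_mono) auto
  have "cmod (wigner_D l m s g) \<le>
      (\<Sum>j<Suc n. C) / cmod (of_nat (Suc n) * complex_of_real (sqrt (real (n choose k))))"
    if g: "g \<in> SU2" for g
  proof -
    have tri: "cmod (x * u + y) \<le> 2" if "cmod x \<le> 1" "cmod u = 1" "cmod y \<le> 1" for x y u
      using norm_triangle_ineq[of "x * u" y] that by (simp add: norm_mult)
    have "cmod (\<Sum>j<Suc n. cnj (?E j k) *
       wigner_psi l s (cnj (g$1$1) * ?E j 1 + cnj (g$2$1)) (- (g$2$1) * ?E j 1 + g$1$1)) \<le> (\<Sum>j<Suc n. C)"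
      using SU2_norm_entries[OF g]
      by (intro sum_norm_le) (auto simp only: norm_mult norm_dft_char complex_mod_cnj mult_1_left
            norm_minus_cancel intro!: C tri)
    then show ?thesis
      by (subst SU2_eq_su2[OF g]) (simp only: k(1) wigner_D_dft[OF n s k(2)] norm_divide divide_right_mono norm_ge_zero)
  qed
  then show ?thesis by blast
qed

section \<open>Coefficients and norms as integrals over the group\<close>

lemma finite_measure_SU2_vol: "finite_measure SU2_vol"
  by (rule finite_measureI) (simp add: emeasure_SU2_vol_SU2)

interpretation SU2_vol: finite_measure SU2_vol
  by (rule finite_measure_SU2_vol)

lemma borel_measurable_cnj [measurable]: "cnj \<in> borel_measurable borel"
  by (intro borel_measurable_continuous_onI continuous_intros)

lemma wigner_phi_measurable:
  assumes "l \<in> half_nats" "m \<in> weights l" "s \<in> weights l"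
  shows "wigner_phi l m s \<in> borel_measurable SU2_vol"
  using wigner_D_measurable[OF assms] unfolding wigner_phi_def[abs_def]
  by (simp cong: measurable_cong_sets add: sets_SU2_vol)

lemma wigner_phi_bounded:
  assumes "l \<in> half_nats" "m \<in> weights l" "s \<in> weights l"
  obtains B where "0 \<le> B" "\<And>g. g \<in> SU2 \<Longrightarrow> cmod (wigner_phi l m s g) \<le> B"
proof -
  obtain B where B: "\<And>g. g \<in> SU2 \<Longrightarrow> cmod (wigner_D l m s g) \<le> B"
    using wigner_D_bounded[OF assms] by blast
  show ?thesis
  proof
    show "0 \<le> cmod (complex_of_real (sqrt (2 * l + 1) / (4 * pi))) * \<bar>B\<bar>" by simp
    fix g assume "g \<in> SU2"
    then show "cmod (wigner_phi l m s g) \<le> cmod (complex_of_real (sqrt (2 * l + 1) / (4 * pi))) * \<bar>B\<bar>"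
      unfolding wigner_phi_def norm_mult using B[of g] by (intro mult_left_mono) auto
  qed
qed

lemma integrable_mult_wigner_phi:
  assumes "l \<in> half_nats" "m \<in> weights l" "s \<in> weights l" and f: "integrable SU2_vol f"
  shows "integrable SU2_vol (\<lambda>g. f g * cnj (wigner_phi l m s g))"
proof -
  obtain B where B: "\<And>g. g \<in> SU2 \<Longrightarrow> cmod (wigner_phi l m s g) \<le> B"
    using wigner_phi_bounded[OF assms(1-3)] by blast
  show ?thesis
  proof (rule Bochner_Integration.integrable_bound)
    show "integrable SU2_vol (\<lambda>g. B * cmod (f g))" using f by simp
    show "(\<lambda>g. f g * cnj (wigner_phi l m s g)) \<in> borel_measurable SU2_vol"
    proof -
      note [measurable] = borel_measurable_integrable[OF f] wigner_phi_measurable[OF assms(1-3)]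
      show ?thesis by measurable
    qed
    show "AE g in SU2_vol. cmod (f g * cnj (wigner_phi l m s g)) \<le> norm (B * cmod (f g))"
    proof (rule AE_I2)
      fix g assume "g \<in> space SU2_vol"
      then have "cmod (wigner_phi l m s g) \<le> B" using B by simp
      moreover from this have "0 \<le> B" using norm_ge_zero order_trans by blast
      ultimately show "cmod (f g * cnj (wigner_phi l m s g)) \<le> norm (B * cmod (f g))"
        by (simp add: norm_mult mult.commute[of B] mult_left_mono)
    qed
  qed
qed

lemma measurable_SU2_vol_mult_left:
  "h \<in> SU2 \<Longrightarrow> (\<lambda>x. h ** x) \<in> measurable SU2_vol SU2_vol"
  using measurable_SU2_mult_left by (simp cong: measurable_cong_sets add: sets_SU2_vol)

lemma measurable_SU2_vol_mult_right:
  "h \<in> SU2 \<Longrightarrow> (\<lambda>x. x ** h) \<in> measurable SU2_vol SU2_vol"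
  using measurable_SU2_mult_right by (simp cong: measurable_cong_sets add: sets_SU2_vol)

text \<open>Invariance of the volume moves the translation from \<open>f\<close> to the basis
  function, where multiplicativity of \<open>wigner_D\<close> expands it. The first index is the one
  that is mixed, through row \<open>m\<close> of \<open>D(h)\<close>.\<close>

lemma wigner_coeff_mult_left:
  assumes l: "l \<in> half_nats" and m: "m \<in> weights l" and s: "s \<in> weights l"
    and h: "h \<in> SU2" and f: "integrable SU2_vol f"
  shows "wigner_coeff l m s (\<lambda>x. f (conj_transpose h ** x)) =
    (\<Sum>k\<in>weights l. cnj (wigner_D l m k h) * wigner_coeff l k s f)"
proof -
  let ?F = "\<lambda>x. f (conj_transpose h ** x) * cnj (wigner_phi l m s x)"
  have "?F \<in> borel_measurable SU2_vol"
  proof -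
    note [measurable] = borel_measurable_integrable[OF f] wigner_phi_measurable[OF l m s]
      measurable_SU2_vol_mult_left[OF SU2_conj_transpose[OF h]]
    show ?thesis by measurable
  qed
  then have "(\<integral>x. ?F x \<partial>SU2_vol) = (\<integral>x. ?F (h ** x) \<partial>SU2_vol)"
    using integral_distr[of "\<lambda>x. h ** x" SU2_vol SU2_vol ?F] h
    by (simp add: distr_SU2_vol_mult_left measurable_SU2_vol_mult_left)
  also have "\<dots> = (\<integral>x. (\<Sum>k\<in>weights l. cnj (wigner_D l m k h) * (f x * cnj (wigner_phi l k s x))) \<partial>SU2_vol)"
  proof (rule Bochner_Integration.integral_cong)
    fix x assume "x \<in> space SU2_vol"
    then have x: "x \<in> SU2" by simp
    have "f (conj_transpose h ** (h ** x)) = f x"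
      by (simp add: matrix_mul_assoc SU2_conj_transpose_mult[OF h])
    then show "?F (h ** x) = (\<Sum>k\<in>weights l. cnj (wigner_D l m k h) * (f x * cnj (wigner_phi l k s x)))"
      unfolding wigner_phi_def wigner_D_mult[OF l s m h x]
      by (simp add: sum_distrib_left sum_divide_distrib mult_ac)
  qed simp
  also have "\<dots> = (\<Sum>k\<in>weights l. cnj (wigner_D l m k h) * wigner_coeff l k s f)"
    unfolding wigner_coeff_def
    by (subst Bochner_Integration.integral_sum) (auto intro!: integrable_mult_wigner_phi l s f)
  finally show ?thesis unfolding wigner_coeff_def .
qed

text \<open>As for left translations, but now \<open>h\<close> is the right factor in
  \<open>wigner_D_mult\<close>, so that the second index is mixed, through column \<open>s\<close>
  of \<open>D(h)\<close>.\<close>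

lemma wigner_coeff_mult_right:
  assumes l: "l \<in> half_nats" and m: "m \<in> weights l" and s: "s \<in> weights l"
    and h: "h \<in> SU2" and f: "integrable SU2_vol f"
  shows "wigner_coeff l m s (\<lambda>x. f (x ** conj_transpose h)) =
    (\<Sum>k\<in>weights l. cnj (wigner_D l k s h) * wigner_coeff l m k f)"
proof -
  let ?F = "\<lambda>x. f (x ** conj_transpose h) * cnj (wigner_phi l m s x)"
  have "?F \<in> borel_measurable SU2_vol"
  proof -
    note [measurable] = borel_measurable_integrable[OF f] wigner_phi_measurable[OF l m s]
      measurable_SU2_vol_mult_right[OF SU2_conj_transpose[OF h]]
    show ?thesis by measurable
  qed
  then have "(\<integral>x. ?F x \<partial>SU2_vol) = (\<integral>x. ?F (x ** h) \<partial>SU2_vol)"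
    using integral_distr[of "\<lambda>x. x ** h" SU2_vol SU2_vol ?F] h
    by (simp add: distr_SU2_vol_mult_right measurable_SU2_vol_mult_right)
  also have "\<dots> = (\<integral>x. (\<Sum>k\<in>weights l. cnj (wigner_D l k s h) * (f x * cnj (wigner_phi l m k x))) \<partial>SU2_vol)"
  proof (rule Bochner_Integration.integral_cong)
    fix x assume "x \<in> space SU2_vol"
    then have x: "x \<in> SU2" by simp
    have "f ((x ** h) ** conj_transpose h) = f x"
      by (simp add: SU2_conj_transpose_mult[OF h] flip: matrix_mul_assoc)
    then show "?F (x ** h) = (\<Sum>k\<in>weights l. cnj (wigner_D l k s h) * (f x * cnj (wigner_phi l m k x)))"
      unfolding wigner_phi_def wigner_D_mult[OF l s m x h]
      by (simp add: sum_distrib_left sum_divide_distrib mult_ac)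
  qed simp
  also have "\<dots> = (\<Sum>k\<in>weights l. cnj (wigner_D l k s h) * wigner_coeff l m k f)"
    unfolding wigner_coeff_def
    by (subst Bochner_Integration.integral_sum) (auto intro!: integrable_mult_wigner_phi l m f)
  finally show ?thesis unfolding wigner_coeff_def .
qed

lemma L2_normsq_distr:
  assumes T: "T \<in> measurable SU2_vol SU2_vol" "distr SU2_vol SU2_vol T = SU2_vol"
    and f [measurable]: "f \<in> borel_measurable SU2_vol"
  shows "L2_normsq (\<lambda>x. f (T x)) = L2_normsq f"
proof -
  have "(\<integral>\<^sup>+ g. ennreal ((cmod (f g))\<^sup>2) \<partial>distr SU2_vol SU2_vol T) =
      (\<integral>\<^sup>+ g. ennreal ((cmod (f (T g)))\<^sup>2) \<partial>SU2_vol)"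
    by (intro nn_integral_distr T) measurable
  then show ?thesis by (simp add: L2_normsq_def T(2))
qed

text \<open>By Cauchy-Schwarz; the bound is trivially true if \<open>f\<close> is not integrable, since then the
  coefficient is \<open>0\<close>.\<close>

lemma wigner_coeff_le_L2_normsq:
  assumes "l \<in> half_nats" "m \<in> weights l" "s \<in> weights l"
  obtains C where "0 \<le> C"
    "\<And>f. f \<in> borel_measurable SU2_vol \<Longrightarrow>
      ennreal ((cmod (wigner_coeff l m s f))\<^sup>2) \<le> ennreal C * L2_normsq f"
proof -
  obtain B where B: "0 \<le> B" "\<And>g. g \<in> SU2 \<Longrightarrow> cmod (wigner_phi l m s g) \<le> B"
    using wigner_phi_bounded[OF assms] by blast
  define V where "V = (\<integral>\<^sup>+ g. (ennreal (cmod (wigner_phi l m s g)))\<^sup>2 \<partial>SU2_vol)"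
  have "V \<le> (\<integral>\<^sup>+ g. ennreal (B\<^sup>2) \<partial>SU2_vol)"
    unfolding V_def using B by (intro nn_integral_mono) (auto simp: ennreal_power power_mono)
  also have "\<dots> < \<infinity>"
    by (simp add: emeasure_SU2_vol_SU2 ennreal_mult_less_top)
  finally have V: "V < \<infinity>" .
  have phi [measurable]: "wigner_phi l m s \<in> borel_measurable SU2_vol"
    by (rule wigner_phi_measurable[OF assms])
  show ?thesis
  proof
    show "0 \<le> enn2real V" by simp
    fix f :: "complex^2^2 \<Rightarrow> complex" assume f [measurable]: "f \<in> borel_measurable SU2_vol"
    let ?F = "\<lambda>g. f g * cnj (wigner_phi l m s g)"
    have 1: "ennreal (cmod (wigner_coeff l m s f)) \<le>
        (\<integral>\<^sup>+ g. ennreal (cmod (f g)) * ennreal (cmod (wigner_phi l m s g)) \<partial>SU2_vol)"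
    proof (cases "integrable SU2_vol ?F")
      case True
      then show ?thesis
        using integral_norm_bound_ennreal[OF True]
        by (simp add: wigner_coeff_def norm_mult ennreal_mult)
    next
      case False
      then show ?thesis by (simp add: wigner_coeff_def not_integrable_integral_eq)
    qed
    have "ennreal ((cmod (wigner_coeff l m s f))\<^sup>2) = (ennreal (cmod (wigner_coeff l m s f)))\<^sup>2"
      by (simp add: ennreal_power)
    also have "\<dots> \<le> (\<integral>\<^sup>+ g. ennreal (cmod (f g)) * ennreal (cmod (wigner_phi l m s g)) \<partial>SU2_vol)\<^sup>2"
      using 1 by (rule power_mono) simp
    also have "\<dots> \<le> (\<integral>\<^sup>+ g. (ennreal (cmod (f g)))\<^sup>2 \<partial>SU2_vol) * V"
      unfolding V_def by (rule Cauchy_Schwarz_nn_integral) measurable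
    also have "\<dots> = ennreal (enn2real V) * L2_normsq f"
      using V by (simp add: L2_normsq_def ennreal_power mult.commute less_top)
    finally show "ennreal ((cmod (wigner_coeff l m s f))\<^sup>2) \<le> ennreal (enn2real V) * L2_normsq f" .
  qed
qed

lemma integrable_if_L2_normsq_finite:
  assumes [measurable]: "f \<in> borel_measurable SU2_vol" and "L2_normsq f < \<infinity>"
  shows "integrable SU2_vol f"
proof (rule SU2_vol.square_integrable_imp_integrable)
  show "integrable SU2_vol (\<lambda>x. (f x)\<^sup>2)"
    using assms(2) unfolding L2_normsq_def
    by (intro integrableI_bounded) (auto simp: norm_power)
qed simp

section \<open>Random fields\<close>

lemma random_field_iff:
  "random_field M X \<longleftrightarrow> prob_space M \<and> case_prod X \<in> borel_measurable (M \<Otimes>\<^sub>M SU2_vol)"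
  unfolding random_field_def by (simp cong: measurable_cong_sets sets_pair_measure_cong add: sets_SU2_vol)

lemma random_field_measurable:
  "random_field M X \<Longrightarrow> case_prod X \<in> borel_measurable (M \<Otimes>\<^sub>M SU2_vol)"
  by (simp add: random_field_iff)

lemma random_field_section:
  assumes "random_field M X" "\<omega> \<in> space M"
  shows "X \<omega> \<in> borel_measurable SU2_vol"
  using measurable_Pair2[OF random_field_measurable[OF assms(1)] assms(2)] by simp

lemma random_field_compose:
  assumes X: "random_field M X" and T [measurable]: "T \<in> measurable SU2_vol SU2_vol"
  shows "random_field M (\<lambda>\<omega> x. X \<omega> (T x))"
proof -
  note [measurable] = random_field_measurable[OF X]
  have "(\<lambda>(\<omega>, x). X \<omega> (T x)) \<in> borel_measurable (M \<Otimes>\<^sub>M SU2_vol)" by measurable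
  then show ?thesis using X by (simp add: random_field_iff)
qed

lemma measurable_wigner_coeff_field:
  assumes X: "random_field M X" and "l \<in> half_nats" "m \<in> weights l" "s \<in> weights l"
  shows "(\<lambda>\<omega>. wigner_coeff l m s (X \<omega>)) \<in> borel_measurable M"
proof -
  note [measurable] = random_field_measurable[OF X] wigner_phi_measurable[OF assms(2-4)]
  show ?thesis unfolding wigner_coeff_def by measurable
qed

lemma measurable_L2_normsq_field:
  assumes X: "random_field M X"
  shows "(\<lambda>\<omega>. L2_normsq (X \<omega>)) \<in> borel_measurable M"
proof -
  note [measurable] = random_field_measurable[OF X]
  show ?thesis unfolding L2_normsq_def by measurable
qed

section \<open>Second moments of the coefficients\<close>

lemma nn_integral_L2_normsq_field:
  assumes X: "random_field M X"
    and var: "\<And>g. g \<in> SU2 \<Longrightarrow> (\<integral>\<^sup>+\<omega>. ennreal ((cmod (X \<omega> g))\<^sup>2) \<partial>M) = ennreal c"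
  shows "(\<integral>\<^sup>+\<omega>. L2_normsq (X \<omega>) \<partial>M) < \<infinity>"
proof -
  interpret prob_space M using X by (simp add: random_field_iff)
  interpret P: pair_sigma_finite M SU2_vol ..
  note [measurable] = random_field_measurable[OF X]
  have "(\<integral>\<^sup>+\<omega>. L2_normsq (X \<omega>) \<partial>M) = (\<integral>\<^sup>+g. (\<integral>\<^sup>+\<omega>. ennreal ((cmod (X \<omega> g))\<^sup>2) \<partial>M) \<partial>SU2_vol)"
    unfolding L2_normsq_def by (rule P.Fubini'[symmetric]) measurable
  also have "\<dots> = (\<integral>\<^sup>+g. ennreal c \<partial>SU2_vol)"
    by (rule nn_integral_cong) (simp add: var)
  also have "\<dots> < \<infinity>" by (simp add: emeasure_SU2_vol_SU2 ennreal_mult_less_top)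
  finally show ?thesis .
qed

text \<open>The right-hand side depends on the field only through its covariance kernel, which is
  what weak invariance controls. \<open>Re\<close> appears because the kernel integral is formally
  complex; the proof shows it to be the real number on the left.\<close>

lemma second_moment_wigner_coeff:
  assumes X: "random_field M X"
    and var: "\<And>g. g \<in> SU2 \<Longrightarrow> (\<integral>\<^sup>+\<omega>. ennreal ((cmod (X \<omega> g))\<^sup>2) \<partial>M) = ennreal c"
    and lms: "l \<in> half_nats" "m \<in> weights l" "s \<in> weights l"
  shows "(\<integral>\<^sup>+\<omega>. ennreal ((cmod (wigner_coeff l m s (X \<omega>)))\<^sup>2) \<partial>M) =
    ennreal (Re (\<integral>p. (\<integral>\<omega>. X \<omega> (fst p) * cnj (X \<omega> (snd p)) \<partial>M) *
      (cnj (wigner_phi l m s (fst p)) * wigner_phi l m s (snd p)) \<partial>(SU2_vol \<Otimes>\<^sub>M SU2_vol)))"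
proof -
  interpret prob_space M using X by (simp add: random_field_iff)
  interpret V2: pair_sigma_finite SU2_vol SU2_vol ..
  interpret VV: finite_measure "SU2_vol \<Otimes>\<^sub>M SU2_vol"
    by (rule finite_measure_pair_measure) (rule finite_measure_SU2_vol)+
  interpret P: pair_sigma_finite M "SU2_vol \<Otimes>\<^sub>M SU2_vol" ..
  let ?\<phi> = "wigner_phi l m s"
  note [measurable] = random_field_measurable[OF X] wigner_phi_measurable[OF lms]
  obtain B where B: "0 \<le> B" "\<And>g. g \<in> SU2 \<Longrightarrow> cmod (?\<phi> g) \<le> B"
    using wigner_phi_bounded[OF lms] by blast
  define Z where "Z \<omega> p = X \<omega> (fst p) * cnj (X \<omega> (snd p)) * (cnj (?\<phi> (fst p)) * ?\<phi> (snd p))" for \<omega> p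
  have Zm: "case_prod Z \<in> borel_measurable (M \<Otimes>\<^sub>M (SU2_vol \<Otimes>\<^sub>M SU2_vol))"
    unfolding Z_def by measurable
  note [measurable] = Zm
  \<comment> \<open>A bound uniform in \<open>p\<close>, from
    \<open>x * y \<le> x\<^sup>2 + y\<^sup>2\<close> and the constant variance; with the finite
    volume it makes \<open>Z\<close> integrable on the whole product.\<close>
  have Z_le: "(\<integral>\<^sup>+\<omega>. ennreal (cmod (Z \<omega> p)) \<partial>M) \<le> ennreal (B * B) * (ennreal c + ennreal c)"
    if p: "p \<in> SU2 \<times> SU2" for p
  proof -
    have [measurable]: "(\<lambda>\<omega>. X \<omega> g) \<in> borel_measurable M" if "g \<in> SU2" for g
      using measurable_Pair1[OF random_field_measurable[OF X], of g] that by simp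
    have p': "fst p \<in> SU2" "snd p \<in> SU2" using p by auto
    have "(\<integral>\<^sup>+\<omega>. ennreal (cmod (Z \<omega> p)) \<partial>M) \<le>
        (\<integral>\<^sup>+\<omega>. ennreal (B * B) * (ennreal ((cmod (X \<omega> (fst p)))\<^sup>2) + ennreal ((cmod (X \<omega> (snd p)))\<^sup>2)) \<partial>M)"
    proof (rule nn_integral_mono)
      fix \<omega>
      have "cmod (?\<phi> (fst p)) * cmod (?\<phi> (snd p)) \<le> B * B"
        using B p' by (intro mult_mono) auto
      moreover have "cmod (X \<omega> (fst p)) * cmod (X \<omega> (snd p)) \<le> (cmod (X \<omega> (fst p)))\<^sup>2 + (cmod (X \<omega> (snd p)))\<^sup>2"
        using sum_squares_bound[of "cmod (X \<omega> (fst p))" "cmod (X \<omega> (snd p))"]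
          mult_nonneg_nonneg[OF norm_ge_zero norm_ge_zero, of "X \<omega> (fst p)" "X \<omega> (snd p)"]
        unfolding mult.assoc by linarith
      ultimately have "cmod (Z \<omega> p) \<le> (B * B) * ((cmod (X \<omega> (fst p)))\<^sup>2 + (cmod (X \<omega> (snd p)))\<^sup>2)"
        unfolding Z_def norm_mult complex_mod_cnj using B(1)
        by (subst mult.commute) (rule mult_mono, auto)
      then show "ennreal (cmod (Z \<omega> p)) \<le>
          ennreal (B * B) * (ennreal ((cmod (X \<omega> (fst p)))\<^sup>2) + ennreal ((cmod (X \<omega> (snd p)))\<^sup>2))"
        using B(1) by (simp add: ennreal_leI flip: ennreal_mult ennreal_plus)
    qed
    also have "\<dots> = ennreal (B * B) * (ennreal c + ennreal c)"
      using p' by (simp add: nn_integral_cmult nn_integral_add var)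
    finally show ?thesis .
  qed
  have int: "integrable (M \<Otimes>\<^sub>M (SU2_vol \<Otimes>\<^sub>M SU2_vol)) (case_prod Z)"
  proof (rule integrableI_bounded[OF Zm])
    have "(\<integral>\<^sup>+x. ennreal (cmod (case_prod Z x)) \<partial>(M \<Otimes>\<^sub>M (SU2_vol \<Otimes>\<^sub>M SU2_vol))) =
        (\<integral>\<^sup>+p. (\<integral>\<^sup>+\<omega>. ennreal (cmod (Z \<omega> p)) \<partial>M) \<partial>(SU2_vol \<Otimes>\<^sub>M SU2_vol))"
      by (subst P.nn_integral_snd[symmetric]) simp_all
    also have "\<dots> \<le> (\<integral>\<^sup>+p. ennreal (B * B) * (ennreal c + ennreal c) \<partial>(SU2_vol \<Otimes>\<^sub>M SU2_vol))"
      by (intro nn_integral_mono Z_le) (auto simp: space_pair_measure)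
    also have "\<dots> < \<infinity>"
      using VV.emeasure_finite[of "space (SU2_vol \<Otimes>\<^sub>M SU2_vol)"]
      by (simp add: ennreal_mult_eq_top_iff top.not_eq_extremum[symmetric])
    finally show "(\<integral>\<^sup>+x. ennreal (cmod (case_prod Z x)) \<partial>(M \<Otimes>\<^sub>M (SU2_vol \<Otimes>\<^sub>M SU2_vol))) < \<infinity>" .
  qed
  \<comment> \<open>The squared modulus of a coefficient is a double integral of \<open>Z\<close>.
    This is claimed only for those \<open>\<omega>\<close> at which \<open>Z\<close> is integrable
    over pairs; by Fubini they are almost all.\<close>
  have sq: "complex_of_real ((cmod (wigner_coeff l m s (X \<omega>)))\<^sup>2) = (\<integral>p. Z \<omega> p \<partial>(SU2_vol \<Otimes>\<^sub>M SU2_vol))"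
    if "integrable (SU2_vol \<Otimes>\<^sub>M SU2_vol) (Z \<omega>)" for \<omega>
  proof -
    let ?F = "\<lambda>g. X \<omega> g * cnj (?\<phi> g)"
    have "complex_of_real ((cmod (wigner_coeff l m s (X \<omega>)))\<^sup>2) =
        (\<integral>g. ?F g \<partial>SU2_vol) * (\<integral>h. cnj (?F h) \<partial>SU2_vol)"
      unfolding complex_norm_square wigner_coeff_def by (simp only: Bochner_Integration.integral_cnj)
    also have "\<dots> = (\<integral>g. (\<integral>h. ?F g * cnj (?F h) \<partial>SU2_vol) \<partial>SU2_vol)"
      by (simp only: integral_mult_left_zero integral_mult_right_zero)
    also have "\<dots> = (\<integral>g. (\<integral>h. Z \<omega> (g, h) \<partial>SU2_vol) \<partial>SU2_vol)"
      by (simp add: Z_def mult_ac)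
    also have "\<dots> = (\<integral>p. Z \<omega> p \<partial>(SU2_vol \<Otimes>\<^sub>M SU2_vol))"
      by (rule V2.integral_fst'[OF that])
    finally show ?thesis .
  qed
  have ae: "AE \<omega> in M. complex_of_real ((cmod (wigner_coeff l m s (X \<omega>)))\<^sup>2) =
      (\<integral>p. Z \<omega> p \<partial>(SU2_vol \<Otimes>\<^sub>M SU2_vol))"
    using P.AE_integrable_fst[OF int] by eventually_elim (rule sq)
  note [measurable] = measurable_wigner_coeff_field[OF X lms]
  have int_sq: "integrable M (\<lambda>\<omega>. complex_of_real ((cmod (wigner_coeff l m s (X \<omega>)))\<^sup>2))"
    using P.integrable_fst[OF int] by (rule integrable_cong_AE_imp) (use ae in auto)
  have "(\<integral>\<omega>. complex_of_real ((cmod (wigner_coeff l m s (X \<omega>)))\<^sup>2) \<partial>M) =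
      (\<integral>\<omega>. (\<integral>p. Z \<omega> p \<partial>(SU2_vol \<Otimes>\<^sub>M SU2_vol)) \<partial>M)"
    by (rule integral_cong_AE) (use ae in auto)
  also have "\<dots> = (\<integral>p. (\<integral>\<omega>. Z \<omega> p \<partial>M) \<partial>(SU2_vol \<Otimes>\<^sub>M SU2_vol))"
    by (rule P.Fubini_integral[OF int, symmetric])
  also have "\<dots> = (\<integral>p. (\<integral>\<omega>. X \<omega> (fst p) * cnj (X \<omega> (snd p)) \<partial>M) *
      (cnj (?\<phi> (fst p)) * ?\<phi> (snd p)) \<partial>(SU2_vol \<Otimes>\<^sub>M SU2_vol))"
    by (simp only: Z_def integral_mult_left_zero)
  finally have eq: "complex_of_real (\<integral>\<omega>. (cmod (wigner_coeff l m s (X \<omega>)))\<^sup>2 \<partial>M) = \<dots>"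
    by (simp only: integral_complex_of_real)
  have "integrable M (\<lambda>\<omega>. (cmod (wigner_coeff l m s (X \<omega>)))\<^sup>2)"
    using int_sq by (simp only: complex_of_real_integrable_eq)
  then have "(\<integral>\<^sup>+\<omega>. ennreal ((cmod (wigner_coeff l m s (X \<omega>)))\<^sup>2) \<partial>M) =
      ennreal (\<integral>\<omega>. (cmod (wigner_coeff l m s (X \<omega>)))\<^sup>2 \<partial>M)"
    by (rule nn_integral_eq_integral) auto
  then show ?thesis unfolding eq[symmetric] by simp
qed

section \<open>Functionals of the law\<close>

lemma measurable_restrict_field:
  assumes X: "random_field M X"
  shows "(\<lambda>\<omega>. restrict (X \<omega>) SU2) \<in> measurable M (\<Pi>\<^sub>M g\<in>SU2. borel)"
proof (rule measurable_restrict)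
  fix g assume "g \<in> SU2"
  then show "(\<lambda>\<omega>. X \<omega> g) \<in> borel_measurable M"
    using measurable_Pair1[OF random_field_measurable[OF X], of g] by simp
qed

text \<open>Integral functionals are in general not measurable on the product space, so equality of laws gives
  equality of their joint moments only through Fubini, one integral at a time.\<close>

lemma expectation_integral_functionals_eq:
  fixes fs :: "(complex \<Rightarrow> complex^2^2 \<Rightarrow> complex) list"
  assumes X: "random_field M X" and Y: "random_field M Y" and law: "field_law M X = field_law M Y"
    and F: "F \<in> borel_measurable (\<Pi>\<^sub>M g\<in>SU2. borel)" "\<And>x. cmod (F x) \<le> B"
    and fs: "\<And>f. f \<in> set fs \<Longrightarrow> case_prod f \<in> borel_measurable (borel \<Otimes>\<^sub>M SU2_vol)"
      "\<And>f. f \<in> set fs \<Longrightarrow> \<exists>C. \<forall>z. \<forall>g\<in>SU2. cmod (f z g) \<le> C"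
  shows "(\<integral>\<omega>. F (restrict (X \<omega>) SU2) * prod_list (map (\<lambda>f. \<integral>g. f (X \<omega> g) g \<partial>SU2_vol) fs) \<partial>M) =
    (\<integral>\<omega>. F (restrict (Y \<omega>) SU2) * prod_list (map (\<lambda>f. \<integral>g. f (Y \<omega> g) g \<partial>SU2_vol) fs) \<partial>M)"
  using F fs
\<comment> \<open>\<open>F\<close> collects the factors already reduced to fixed points of the
  group; it changes in every step, so the induction is over arbitrary \<open>F\<close>.\<close>
proof (induction fs arbitrary: F B)
  case Nil
  have *: "(\<integral>\<omega>. F (restrict (Z \<omega>) SU2) \<partial>M) = (\<integral>x. F x \<partial>field_law M Z)" if "random_field M Z" for Z
    unfolding field_law_def by (rule integral_distr[symmetric, OF measurable_restrict_field[OF that] Nil(1)])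
  show ?case by (simp only: list.map prod_list.Nil mult_1_right *[OF X] *[OF Y] law)
next
  case (Cons f fs)
  note [measurable] = Cons.prems(1)
  have f [measurable]: "case_prod f \<in> borel_measurable (borel \<Otimes>\<^sub>M SU2_vol)"
    using Cons.prems(3) by simp
  have fs: "case_prod f \<in> borel_measurable (borel \<Otimes>\<^sub>M SU2_vol)" if "f \<in> set fs" for f
    using Cons.prems(3) that by simp
  obtain C where C: "\<And>z g. g \<in> SU2 \<Longrightarrow> cmod (f z g) \<le> C" using Cons.prems(4)[of f] by auto
  define J where "J Z \<omega> = prod_list (map (\<lambda>f. \<integral>g. f (Z \<omega> g) g \<partial>SU2_vol) fs)"
    for Z :: "'a \<Rightarrow> complex^2^2 \<Rightarrow> complex" and \<omega>
  \<comment> \<open>Fubini takes one integral over the group out of the expectation. For fixed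
    \<open>g\<close> the factor \<open>f (Z \<omega> g) g\<close> depends on the single coordinate
    \<open>g\<close> and can be absorbed into \<open>F\<close>.\<close>
  have step: "(\<integral>\<omega>. F (restrict (Z \<omega>) SU2) * ((\<integral>g. f (Z \<omega> g) g \<partial>SU2_vol) * J Z \<omega>) \<partial>M) =
      (\<integral>g. (\<integral>\<omega>. (F (restrict (Z \<omega>) SU2) * f (Z \<omega> g) g) * J Z \<omega> \<partial>M) \<partial>SU2_vol)"
    if Z: "random_field M Z" for Z
  proof -
    interpret prob_space M using Z by (simp add: random_field_iff)
    interpret P: pair_sigma_finite M SU2_vol ..
    interpret PF: finite_measure "M \<Otimes>\<^sub>M SU2_vol"
      by (intro finite_measure_pair_measure finite_measure_SU2_vol) unfold_locales
    note [measurable] = random_field_measurable[OF Z] measurable_restrict_field[OF Z]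
    \<comment> \<open>The remaining product of integrals is bounded uniformly in
      \<open>\<omega>\<close>, as every integrand is bounded and the volume is finite.\<close>
    have "\<exists>D. \<forall>\<omega>. cmod (J Z \<omega>) \<le> D"
      unfolding J_def using Cons.prems(4)
    proof (induction fs)
      case (Cons f' fs)
      then obtain D where D: "\<And>\<omega>. cmod (prod_list (map (\<lambda>f. \<integral>g. f (Z \<omega> g) g \<partial>SU2_vol) fs)) \<le> D"
        by auto
      obtain C' where C': "\<And>z g. g \<in> SU2 \<Longrightarrow> cmod (f' z g) \<le> C'" using Cons.prems(1)[of f'] by auto
      have "cmod (\<integral>g. f' (Z \<omega> g) g \<partial>SU2_vol) \<le> C' * measure SU2_vol (space SU2_vol)" for \<omega>
      proof (cases "integrable SU2_vol (\<lambda>g. f' (Z \<omega> g) g)")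
        case True
        have "cmod (\<integral>g. f' (Z \<omega> g) g \<partial>SU2_vol) \<le> (\<integral>g. C' \<partial>SU2_vol)"
          using True by (intro order_trans[OF integral_norm_bound] integral_mono) (auto intro: C')
        then show ?thesis by (simp add: mult.commute)
      next
        case False
        \<comment> \<open>A non-integrable integrand has integral 0 by convention, so the bound must
          be nonnegative; any point of the group shows that.\<close>
        have "su2 1 0 \<in> SU2" by (rule su2_in_SU2) simp
        then have "0 \<le> C'" using order_trans[OF norm_ge_zero C'] by blast
        then show ?thesis using False by (simp add: not_integrable_integral_eq)
      qed
      then have "cmod (prod_list (map (\<lambda>f. \<integral>g. f (Z \<omega> g) g \<partial>SU2_vol) (f' # fs))) \<le>
          (C' * measure SU2_vol (space SU2_vol)) * D" for \<omega>
        using D[of \<omega>] unfolding list.map prod_list.Cons norm_mult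
        by (meson mult_mono' norm_ge_zero)
      then show ?case by blast
    qed (auto intro: exI[of _ 1])
    then obtain D where D: "\<And>\<omega>. cmod (J Z \<omega>) \<le> D" by blast
    have [measurable]: "J Z \<in> borel_measurable M"
      unfolding J_def using fs
    proof (induction fs)
      case (Cons f' fs)
      then have [measurable]: "case_prod f' \<in> borel_measurable (borel \<Otimes>\<^sub>M SU2_vol)"
        "(\<lambda>\<omega>. prod_list (map (\<lambda>f. \<integral>g. f (Z \<omega> g) g \<partial>SU2_vol) fs)) \<in> borel_measurable M"
        by auto
      show ?case unfolding list.map prod_list.Cons by measurable
    qed simp
    have m: "(\<lambda>(\<omega>, g). (F (restrict (Z \<omega>) SU2) * f (Z \<omega> g) g) * J Z \<omega>) \<in> borel_measurable (M \<Otimes>\<^sub>M SU2_vol)"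
      by measurable
    have int: "integrable (M \<Otimes>\<^sub>M SU2_vol) (\<lambda>(\<omega>, g). (F (restrict (Z \<omega>) SU2) * f (Z \<omega> g) g) * J Z \<omega>)"
    proof (rule PF.integrable_const_bound[OF _ m, where B = "(B * C) * D"], rule AE_I2)
      fix p assume p: "p \<in> space (M \<Otimes>\<^sub>M SU2_vol)"
      obtain \<omega> g where [simp]: "p = (\<omega>, g)" by (cases p)
      have "cmod (f (Z \<omega> g) g) \<le> C" using p by (intro C) (simp add: space_pair_measure)
      then show "cmod (case p of (\<omega>, g) \<Rightarrow> (F (restrict (Z \<omega>) SU2) * f (Z \<omega> g) g) * J Z \<omega>) \<le> (B * C) * D"
        using Cons.prems(2)[of "restrict (Z \<omega>) SU2"] D[of \<omega>]
        unfolding \<open>p = (\<omega>, g)\<close> prod.case norm_mult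
        by (intro mult_mono' mult_nonneg_nonneg norm_ge_zero)
    qed
    have "(\<integral>\<omega>. F (restrict (Z \<omega>) SU2) * ((\<integral>g. f (Z \<omega> g) g \<partial>SU2_vol) * J Z \<omega>) \<partial>M) =
        (\<integral>\<omega>. (\<integral>g. (F (restrict (Z \<omega>) SU2) * f (Z \<omega> g) g) * J Z \<omega> \<partial>SU2_vol) \<partial>M)"
      by (simp add: mult.assoc)
    also have "\<dots> = (\<integral>g. (\<integral>\<omega>. (F (restrict (Z \<omega>) SU2) * f (Z \<omega> g) g) * J Z \<omega> \<partial>M) \<partial>SU2_vol)"
      by (rule P.Fubini_integral[OF int, symmetric])
    finally show ?thesis .
  qed
  have ptw: "(\<integral>\<omega>. (F (restrict (X \<omega>) SU2) * f (X \<omega> g) g) * J X \<omega> \<partial>M) =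
      (\<integral>\<omega>. (F (restrict (Y \<omega>) SU2) * f (Y \<omega> g) g) * J Y \<omega> \<partial>M)" if g: "g \<in> SU2" for g
  proof -
    have [measurable]: "(\<lambda>z. f z g) \<in> borel_measurable borel"
      using measurable_Pair1[OF f, of g] g by simp
    have "(\<lambda>x. F x * f (x g) g) \<in> borel_measurable (\<Pi>\<^sub>M g\<in>SU2. borel)"
      using g by measurable
    moreover have "cmod (F x * f (x g) g) \<le> B * C" for x
      unfolding norm_mult using Cons.prems(2) C[OF g] by (intro mult_mono') auto
    ultimately have "(\<integral>\<omega>. (F (restrict (X \<omega>) SU2) * f (restrict (X \<omega>) SU2 g) g) * J X \<omega> \<partial>M) =
      (\<integral>\<omega>. (F (restrict (Y \<omega>) SU2) * f (restrict (Y \<omega>) SU2 g) g) * J Y \<omega> \<partial>M)"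
      unfolding J_def by (rule Cons.IH) (use Cons.prems in auto)
    then show ?thesis using g by simp
  qed
  have "(\<integral>g. (\<integral>\<omega>. (F (restrict (X \<omega>) SU2) * f (X \<omega> g) g) * J X \<omega> \<partial>M) \<partial>SU2_vol) =
      (\<integral>g. (\<integral>\<omega>. (F (restrict (Y \<omega>) SU2) * f (Y \<omega> g) g) * J Y \<omega> \<partial>M) \<partial>SU2_vol)"
    by (rule Bochner_Integration.integral_cong[OF refl], rule ptw) simp
  then have "(\<integral>\<omega>. F (restrict (X \<omega>) SU2) * ((\<integral>g. f (X \<omega> g) g \<partial>SU2_vol) * J X \<omega>) \<partial>M) =
      (\<integral>\<omega>. F (restrict (Y \<omega>) SU2) * ((\<integral>g. f (Y \<omega> g) g \<partial>SU2_vol) * J Y \<omega>) \<partial>M)"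
    by (simp only: step[OF X] step[OF Y])
  then show ?case by (simp only: J_def list.map prod_list.Cons)
qed

section \<open>Truncated fields and the ratio of squared coefficient and squared norm\<close>

definition truncate_at :: "nat \<Rightarrow> complex \<Rightarrow> complex" where
  "truncate_at N z = (if cmod z \<le> real N then z else 0)"

lemma measurable_truncate_at [measurable]: "truncate_at N \<in> borel_measurable borel"
  unfolding truncate_at_def[abs_def] by measurable

lemma norm_truncate_at_le: "cmod (truncate_at N z) \<le> real N" "cmod (truncate_at N z) \<le> cmod z"
  by (auto simp: truncate_at_def)

text \<open>Large values are replaced by 0, so for fixed \<open>z\<close> the sequence is constant
  as soon as \<open>N\<close> exceeds the modulus.\<close>

lemma truncate_at_tendsto: "(\<lambda>N. truncate_at N z) \<longlonglongrightarrow> z"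
proof (rule tendsto_eventually)
  obtain K where "cmod z \<le> real K" using real_arch_simple by blast
  then show "\<forall>\<^sub>F N in sequentially. truncate_at N z = z"
    by (intro eventually_sequentiallyI[of K]) (auto simp: truncate_at_def)
qed

lemma random_field_truncate_at:
  assumes X: "random_field M X"
  shows "random_field M (\<lambda>\<omega> g. truncate_at N (X \<omega> g))"
proof -
  note [measurable] = random_field_measurable[OF X]
  have "(\<lambda>(\<omega>, g). truncate_at N (X \<omega> g)) \<in> borel_measurable (M \<Otimes>\<^sub>M SU2_vol)" by measurable
  then show ?thesis using X by (simp add: random_field_iff)
qed

lemma integrable_truncate_at:
  assumes [measurable]: "f \<in> borel_measurable SU2_vol"
  shows "integrable SU2_vol (\<lambda>g. (cmod (truncate_at N (f g)))\<^sup>2)"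
    and "L2_normsq (\<lambda>g. truncate_at N (f g)) =
      ennreal (\<integral>g. (cmod (truncate_at N (f g)))\<^sup>2 \<partial>SU2_vol)"
proof -
  show 1: "integrable SU2_vol (\<lambda>g. (cmod (truncate_at N (f g)))\<^sup>2)"
    by (rule SU2_vol.integrable_const_bound[where B = "(real N)\<^sup>2"])
       (auto intro!: power_mono norm_truncate_at_le)
  show "L2_normsq (\<lambda>g. truncate_at N (f g)) =
      ennreal (\<integral>g. (cmod (truncate_at N (f g)))\<^sup>2 \<partial>SU2_vol)"
    unfolding L2_normsq_def by (rule nn_integral_eq_integral[OF 1]) simp
qed

text \<open>Real division makes this 0 when the truncated function has norm 0.\<close>

definition truncated_ratio ::
  "real \<Rightarrow> real \<Rightarrow> real \<Rightarrow> nat \<Rightarrow> (complex^2^2 \<Rightarrow> complex) \<Rightarrow> real" where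
  "truncated_ratio l m s N f = (cmod (wigner_coeff l m s (\<lambda>g. truncate_at N (f g))))\<^sup>2 /
     (\<integral>g. (cmod (truncate_at N (f g)))\<^sup>2 \<partial>SU2_vol)"

lemma measurable_truncated_ratio:
  assumes X: "random_field M X" and lms: "l \<in> half_nats" "m \<in> weights l" "s \<in> weights l"
  shows "(\<lambda>\<omega>. truncated_ratio l m s N (X \<omega>)) \<in> borel_measurable M"
proof -
  note [measurable] = random_field_measurable[OF X]
    measurable_wigner_coeff_field[OF random_field_truncate_at[OF X] lms]
  show ?thesis unfolding truncated_ratio_def by measurable
qed

text \<open>The integrand is expanded as a geometric series: with \<open>b\<close> the squared norm of the truncated
  field and \<open>V\<close> the volume, \<open>1 / b\<close> is \<open>(1 / (N\<^sup>2 V)) * (\<Sum>j. q ^ j)\<close> for \<open>q = 1 - b / (N\<^sup>2 V)\<close>, and both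
  \<open>q\<close> and the coefficient are integral functionals with bounded integrand.\<close>

lemma nn_integral_truncated_ratio_eq:
  assumes X: "random_field M X" and Y: "random_field M Y" and law: "field_law M X = field_law M Y"
    and lms: "l \<in> half_nats" "m \<in> weights l" "s \<in> weights l" and N: "0 < N"
  shows "(\<integral>\<^sup>+\<omega>. ennreal (truncated_ratio l m s N (X \<omega>)) \<partial>M) =
    (\<integral>\<^sup>+\<omega>. ennreal (truncated_ratio l m s N (Y \<omega>)) \<partial>M)"
proof -
  let ?\<phi> = "wigner_phi l m s"
  define V where "V = measure SU2_vol SU2"
  have V: "V > 0" by (simp add: V_def measure_def emeasure_SU2_vol_SU2)
  note [measurable] = wigner_phi_measurable[OF lms]
  obtain B where B: "0 \<le> B" "\<And>g. g \<in> SU2 \<Longrightarrow> cmod (?\<phi> g) \<le> B"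
    using wigner_phi_bounded[OF lms] by blast
  obtain C where C: "0 \<le> C" "\<And>f. f \<in> borel_measurable SU2_vol \<Longrightarrow>
      ennreal ((cmod (wigner_coeff l m s f))\<^sup>2) \<le> ennreal C * L2_normsq f"
    using wigner_coeff_le_L2_normsq[OF lms] by blast
  \<comment> \<open>Integrating \<open>f1\<close> and \<open>f2\<close> gives the truncated
    coefficient and its conjugate, whose product is \<open>a\<close>. The factor
    \<open>1 / V\<close> in \<open>f3\<close> turns the constant 1 into a function of integral 1, so
    that \<open>f3\<close> integrates to \<open>q\<close>.\<close>
  define f1 f2 f3 where "f1 z g = truncate_at N z * cnj (?\<phi> g)"
    and "f2 z g = cnj (truncate_at N z * cnj (?\<phi> g))"
    and "f3 z g = complex_of_real ((1 - (cmod (truncate_at N z))\<^sup>2 / (real N)\<^sup>2) / V)"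
    for z :: complex and g :: "complex^2^2"
  define a where "a f = (cmod (wigner_coeff l m s (\<lambda>g. truncate_at N (f g))))\<^sup>2" for f
  define b where "b f = (\<integral>g. (cmod (truncate_at N (f g)))\<^sup>2 \<partial>SU2_vol)" for f
  define q where "q f = (\<integral>g. (1 - (cmod (truncate_at N (f g)))\<^sup>2 / (real N)\<^sup>2) / V \<partial>SU2_vol)" for f
  have m1: "case_prod f1 \<in> borel_measurable (borel \<Otimes>\<^sub>M SU2_vol)"
    "case_prod f2 \<in> borel_measurable (borel \<Otimes>\<^sub>M SU2_vol)"
    "case_prod f3 \<in> borel_measurable (borel \<Otimes>\<^sub>M SU2_vol)"
    unfolding f1_def f2_def f3_def by measurable
  have sq_le: "(cmod (truncate_at N z))\<^sup>2 / (real N)\<^sup>2 \<le> 1" for z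
    using N by (simp add: power_mono norm_truncate_at_le)
  have bd1: "cmod (f1 z g) \<le> real N * B" "cmod (f2 z g) \<le> real N * B" if "g \<in> SU2" for z g
    unfolding f1_def f2_def complex_mod_cnj norm_mult using B(2)[OF that]
    by (intro mult_mono norm_truncate_at_le; simp)+
  have bd3: "cmod (f3 z g) \<le> 1 / V" for z g
    unfolding f3_def norm_of_real using sq_le[of z] V
    by (simp add: abs_le_iff divide_right_mono)
  have q_eq: "q f = 1 - b f / ((real N)\<^sup>2 * V)" if [measurable]: "f \<in> borel_measurable SU2_vol" for f
    using integrable_truncate_at(1)[OF that, of N] V
    by (simp add: q_def b_def V_def diff_divide_distrib)
  have b0: "0 \<le> b f" for f by (simp add: b_def)
  have q0: "0 \<le> q f" for f
    unfolding q_def using V sq_le by (intro Bochner_Integration.integral_nonneg) auto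
  have q1: "q f \<le> 1" if "f \<in> borel_measurable SU2_vol" for f
    unfolding q_eq[OF that] using b0[of f] V by simp
  have a0: "0 \<le> a f" for f by (simp add: a_def)
  have ab: "a f \<le> C * b f" if [measurable]: "f \<in> borel_measurable SU2_vol" for f
  proof -
    have "ennreal (a f) \<le> ennreal C * ennreal (b f)"
      using C(2)[of "\<lambda>g. truncate_at N (f g)"] integrable_truncate_at(2)[OF that, of N]
      by (simp add: a_def b_def)
    then show ?thesis using C(1) b0[of f] by (simp add: ennreal_le_iff flip: ennreal_mult)
  qed
  have series: "ennreal (truncated_ratio l m s N f) =
      ennreal (1 / ((real N)\<^sup>2 * V)) * (\<Sum>j. ennreal (a f * q f ^ j))"
    if f: "f \<in> borel_measurable SU2_vol" for f
  proof (cases "b f = 0")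
    case True
    then have "a f = 0" using ab[OF f] a0[of f] by simp
    then show ?thesis using True by (simp add: truncated_ratio_def flip: a_def b_def)
  next
    case False
    then have b: "b f > 0" using b0[of f] by simp
    have "q f < 1" unfolding q_eq[OF f] using b V N by simp
    then have "(\<lambda>j. a f * q f ^ j) sums (a f * (1 / (1 - q f)))"
      using q0[of f] by (intro sums_mult geometric_sums) simp
    then have "(\<Sum>j. ennreal (a f * q f ^ j)) = ennreal (a f * (1 / (1 - q f)))"
      using a0 q0 by (intro suminf_ennreal_eq) auto
    also have "1 / (1 - q f) = (real N)\<^sup>2 * V / b f"
      unfolding q_eq[OF f] using b by simp
    finally show ?thesis
      using a0[of f] b V N
      by (simp add: truncated_ratio_def flip: a_def b_def ennreal_mult)
  qed
  have moments: "(\<integral>\<omega>. a (X \<omega>) * q (X \<omega>) ^ j \<partial>M) = (\<integral>\<omega>. a (Y \<omega>) * q (Y \<omega>) ^ j \<partial>M)" for j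
  proof -
    \<comment> \<open>The product of these \<open>j + 2\<close> integrals is
      \<open>a * q ^ j\<close>, so the general statement on joint moments applies with
      \<open>F\<close> equal to 1.\<close>
    let ?fs = "f1 # f2 # replicate j f3"
    have eq: "1 * prod_list (map (\<lambda>f. \<integral>g. f (Z \<omega> g) g \<partial>SU2_vol) ?fs) =
        complex_of_real (a (Z \<omega>) * q (Z \<omega>) ^ j)" for Z :: "'a \<Rightarrow> complex^2^2 \<Rightarrow> complex" and \<omega>
    proof -
      have "(\<integral>g. f2 (Z \<omega> g) g \<partial>SU2_vol) = cnj (\<integral>g. f1 (Z \<omega> g) g \<partial>SU2_vol)"
        by (simp only: f1_def f2_def Bochner_Integration.integral_cnj)
      moreover have "(\<integral>g. f3 (Z \<omega> g) g \<partial>SU2_vol) = complex_of_real (q (Z \<omega>))"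
        by (simp only: f3_def q_def integral_complex_of_real)
      moreover have "(\<integral>g. f1 (Z \<omega> g) g \<partial>SU2_vol) = wigner_coeff l m s (\<lambda>g. truncate_at N (Z \<omega> g))"
        by (simp only: f1_def wigner_coeff_def)
      ultimately show ?thesis
        unfolding a_def of_real_mult complex_norm_square
        by (simp only: of_real_power list.map prod_list.Cons map_replicate prod_list_replicate mult_1_left mult.assoc)
    qed
    have "(\<integral>\<omega>. 1 * prod_list (map (\<lambda>f. \<integral>g. f (X \<omega> g) g \<partial>SU2_vol) ?fs) \<partial>M) =
        (\<integral>\<omega>. 1 * prod_list (map (\<lambda>f. \<integral>g. f (Y \<omega> g) g \<partial>SU2_vol) ?fs) \<partial>M)"
    proof (rule expectation_integral_functionals_eq[OF X Y law, where F = "\<lambda>_. 1" and B = 1])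
      fix f assume "f \<in> set ?fs"
      then have f: "f = f1 \<or> f = f2 \<or> f = f3" by auto
      show "case_prod f \<in> borel_measurable (borel \<Otimes>\<^sub>M SU2_vol)" using f m1 by blast
      show "\<exists>C. \<forall>z. \<forall>g\<in>SU2. cmod (f z g) \<le> C" using f bd1 bd3 by blast
    qed auto
    then have "complex_of_real (\<integral>\<omega>. a (X \<omega>) * q (X \<omega>) ^ j \<partial>M) =
        complex_of_real (\<integral>\<omega>. a (Y \<omega>) * q (Y \<omega>) ^ j \<partial>M)"
      by (simp only: eq integral_complex_of_real)
    then show ?thesis unfolding of_real_eq_iff .
  qed
  have expand: "(\<integral>\<^sup>+\<omega>. ennreal (truncated_ratio l m s N (Z \<omega>)) \<partial>M) =
      ennreal (1 / ((real N)\<^sup>2 * V)) * (\<Sum>j. ennreal (\<integral>\<omega>. a (Z \<omega>) * q (Z \<omega>) ^ j \<partial>M))"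
    if Z: "random_field M Z" for Z
  proof -
    interpret prob_space M using Z by (simp add: random_field_iff)
    note [measurable] = random_field_measurable[OF Z]
      measurable_wigner_coeff_field[OF random_field_truncate_at[OF Z] lms]
    have [measurable]: "(\<lambda>\<omega>. a (Z \<omega>)) \<in> borel_measurable M" "(\<lambda>\<omega>. q (Z \<omega>)) \<in> borel_measurable M"
      unfolding a_def q_def by measurable
    have sec: "Z \<omega> \<in> borel_measurable SU2_vol" if "\<omega> \<in> space M" for \<omega>
      using random_field_section[OF Z that] .
    have b_le: "b (Z \<omega>) \<le> (real N)\<^sup>2 * V" if "\<omega> \<in> space M" for \<omega>
      using q0[of "Z \<omega>"] V N unfolding q_eq[OF sec[OF that]] by simp
    have int: "integrable M (\<lambda>\<omega>. a (Z \<omega>) * q (Z \<omega>) ^ j)" for j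
    proof (rule integrable_const_bound[where B = "C * ((real N)\<^sup>2 * V)"], rule AE_I2)
      fix \<omega> assume w: "\<omega> \<in> space M"
      have "a (Z \<omega>) * q (Z \<omega>) ^ j \<le> a (Z \<omega>) * 1"
        using q0 q1[OF sec[OF w]] a0 by (intro mult_left_mono power_le_one)
      also have "\<dots> \<le> C * ((real N)\<^sup>2 * V)"
        using ab[OF sec[OF w]] mult_left_mono[OF b_le[OF w] C(1)] by simp
      finally show "norm (a (Z \<omega>) * q (Z \<omega>) ^ j) \<le> C * ((real N)\<^sup>2 * V)"
        using a0 q0 by simp
    qed measurable
    have "(\<integral>\<^sup>+\<omega>. ennreal (truncated_ratio l m s N (Z \<omega>)) \<partial>M) =
        (\<integral>\<^sup>+\<omega>. ennreal (1 / ((real N)\<^sup>2 * V)) * (\<Sum>j. ennreal (a (Z \<omega>) * q (Z \<omega>) ^ j)) \<partial>M)"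
      by (rule nn_integral_cong) (simp only: series sec)
    also have "\<dots> = ennreal (1 / ((real N)\<^sup>2 * V)) * (\<Sum>j. \<integral>\<^sup>+\<omega>. ennreal (a (Z \<omega>) * q (Z \<omega>) ^ j) \<partial>M)"
      by (subst nn_integral_cmult) (simp_all add: nn_integral_suminf)
    also have "(\<lambda>j. \<integral>\<^sup>+\<omega>. ennreal (a (Z \<omega>) * q (Z \<omega>) ^ j) \<partial>M) =
        (\<lambda>j. ennreal (\<integral>\<omega>. a (Z \<omega>) * q (Z \<omega>) ^ j \<partial>M))"
      using a0 q0 by (intro ext nn_integral_eq_integral[OF int]) auto
    finally show ?thesis .
  qed
  show ?thesis by (simp only: expand[OF X] expand[OF Y] moments)
qed

text \<open>Numerator and denominator converge separately by dominated convergence, with the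
  untruncated integrands as bounds; the limit of the denominator is positive by
  \<open>pos\<close>.\<close>

lemma truncated_ratio_tendsto:
  assumes lms: "l \<in> half_nats" "m \<in> weights l" "s \<in> weights l"
    and f [measurable]: "f \<in> borel_measurable SU2_vol"
    and fin: "L2_normsq f < \<infinity>" and pos: "L2_normsq f > 0"
  shows "(\<lambda>N. ennreal (truncated_ratio l m s N f)) \<longlonglongrightarrow>
    ennreal ((cmod (wigner_coeff l m s f))\<^sup>2) / L2_normsq f"
proof -
  let ?\<phi> = "wigner_phi l m s"
  note [measurable] = wigner_phi_measurable[OF lms]
  have int: "integrable SU2_vol f" by (rule integrable_if_L2_normsq_finite[OF f fin])
  have intphi: "integrable SU2_vol (\<lambda>g. cmod (f g * cnj (?\<phi> g)))"
    using integrable_mult_wigner_phi[OF lms int] by simp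
  have intsq: "integrable SU2_vol (\<lambda>g. (cmod (f g))\<^sup>2)"
    using fin unfolding L2_normsq_def by (intro integrableI_bounded) auto
  have nsq: "L2_normsq f = ennreal (\<integral>g. (cmod (f g))\<^sup>2 \<partial>SU2_vol)"
    unfolding L2_normsq_def by (rule nn_integral_eq_integral[OF intsq]) simp
  then have b: "(\<integral>g. (cmod (f g))\<^sup>2 \<partial>SU2_vol) > 0" using pos by simp
  have "(\<lambda>N. wigner_coeff l m s (\<lambda>g. truncate_at N (f g))) \<longlonglongrightarrow> wigner_coeff l m s f"
    unfolding wigner_coeff_def
  proof (rule integral_dominated_convergence[OF _ _ intphi])
    show "AE g in SU2_vol. (\<lambda>N. truncate_at N (f g) * cnj (?\<phi> g)) \<longlonglongrightarrow> f g * cnj (?\<phi> g)"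
      by (intro AE_I2 tendsto_intros truncate_at_tendsto)
    show "AE g in SU2_vol. norm (truncate_at N (f g) * cnj (?\<phi> g)) \<le> cmod (f g * cnj (?\<phi> g))" for N
      by (intro AE_I2) (simp add: norm_mult mult_right_mono norm_truncate_at_le)
  qed measurable
  moreover have "(\<lambda>N. \<integral>g. (cmod (truncate_at N (f g)))\<^sup>2 \<partial>SU2_vol) \<longlonglongrightarrow> (\<integral>g. (cmod (f g))\<^sup>2 \<partial>SU2_vol)"
  proof (rule integral_dominated_convergence[OF _ _ intsq])
    show "AE g in SU2_vol. (\<lambda>N. (cmod (truncate_at N (f g)))\<^sup>2) \<longlonglongrightarrow> (cmod (f g))\<^sup>2"
      by (intro AE_I2 tendsto_intros truncate_at_tendsto)
    show "AE g in SU2_vol. norm ((cmod (truncate_at N (f g)))\<^sup>2) \<le> (cmod (f g))\<^sup>2" for N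
      by (intro AE_I2) (simp add: power_mono norm_truncate_at_le)
  qed measurable
  ultimately have "(\<lambda>N. truncated_ratio l m s N f) \<longlonglongrightarrow>
      (cmod (wigner_coeff l m s f))\<^sup>2 / (\<integral>g. (cmod (f g))\<^sup>2 \<partial>SU2_vol)"
    unfolding truncated_ratio_def using b by (intro tendsto_intros) auto
  then show ?thesis
    unfolding nsq using b by (simp add: divide_ennreal tendsto_ennrealI)
qed

text \<open>Cauchy-Schwarz for the truncated function gives a constant that depends on neither
  \<open>f\<close> nor \<open>N\<close>, so it serves as dominating function when \<open>N\<close>
  tends to infinity.\<close>

lemma truncated_ratio_bounded:
  assumes lms: "l \<in> half_nats" "m \<in> weights l" "s \<in> weights l"
  obtains C where "\<And>f N. f \<in> borel_measurable SU2_vol \<Longrightarrow> truncated_ratio l m s N f \<le> C"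
proof -
  obtain C where C: "0 \<le> C" "\<And>f. f \<in> borel_measurable SU2_vol \<Longrightarrow>
      ennreal ((cmod (wigner_coeff l m s f))\<^sup>2) \<le> ennreal C * L2_normsq f"
    using wigner_coeff_le_L2_normsq[OF lms] by blast
  show ?thesis
  proof
    fix f :: "complex^2^2 \<Rightarrow> complex" and N assume f [measurable]: "f \<in> borel_measurable SU2_vol"
    let ?a = "(cmod (wigner_coeff l m s (\<lambda>g. truncate_at N (f g))))\<^sup>2"
      and ?b = "\<integral>g. (cmod (truncate_at N (f g)))\<^sup>2 \<partial>SU2_vol"
    have b0: "0 \<le> ?b" by simp
    have "ennreal ?a \<le> ennreal C * ennreal ?b"
      using C(2)[of "\<lambda>g. truncate_at N (f g)"] integrable_truncate_at(2)[OF f, of N] by simp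
    then have "?a \<le> C * ?b" using C(1) b0 by (simp add: ennreal_le_iff flip: ennreal_mult)
    then show "truncated_ratio l m s N f \<le> C"
      unfolding truncated_ratio_def using b0 C(1)
      by (cases "?b = 0") (simp_all add: pos_divide_le_eq order_less_le)
  qed
qed

text \<open>The truncated expectations agree for all \<open>N > 0\<close>, and dominated convergence
  on the probability space carries this over to the limit.\<close>

lemma expected_ratio_law:
  assumes X: "random_field M X" and Y: "random_field M Y" and law: "field_law M X = field_law M Y"
    and lms: "l \<in> half_nats" "m \<in> weights l" "s \<in> weights l"
    and fin: "AE \<omega> in M. L2_normsq (X \<omega>) < \<infinity>" "AE \<omega> in M. L2_normsq (Y \<omega>) < \<infinity>"
    and pos: "AE \<omega> in M. L2_normsq (X \<omega>) > 0" "AE \<omega> in M. L2_normsq (Y \<omega>) > 0"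
  shows "(\<integral>\<^sup>+\<omega>. ennreal ((cmod (wigner_coeff l m s (X \<omega>)))\<^sup>2) / L2_normsq (X \<omega>) \<partial>M) =
    (\<integral>\<^sup>+\<omega>. ennreal ((cmod (wigner_coeff l m s (Y \<omega>)))\<^sup>2) / L2_normsq (Y \<omega>) \<partial>M)"
proof -
  obtain C where C: "\<And>f N. f \<in> borel_measurable SU2_vol \<Longrightarrow> truncated_ratio l m s N f \<le> C"
    using truncated_ratio_bounded[OF lms] by blast
  have lim: "(\<lambda>N. \<integral>\<^sup>+\<omega>. ennreal (truncated_ratio l m s N (Z \<omega>)) \<partial>M) \<longlonglongrightarrow>
      (\<integral>\<^sup>+\<omega>. ennreal ((cmod (wigner_coeff l m s (Z \<omega>)))\<^sup>2) / L2_normsq (Z \<omega>) \<partial>M)"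
    if Z: "random_field M Z" and fin: "AE \<omega> in M. L2_normsq (Z \<omega>) < \<infinity>"
      and pos: "AE \<omega> in M. L2_normsq (Z \<omega>) > 0" for Z
  proof (rule nn_integral_dominated_convergence[where w = "\<lambda>_. ennreal C"])
    interpret prob_space M using Z by (simp add: random_field_iff)
    note [measurable] = measurable_truncated_ratio[OF Z lms] measurable_wigner_coeff_field[OF Z lms]
      measurable_L2_normsq_field[OF Z]
    show "(\<lambda>\<omega>. ennreal (truncated_ratio l m s N (Z \<omega>))) \<in> borel_measurable M" for N by measurable
    show "(\<lambda>\<omega>. ennreal ((cmod (wigner_coeff l m s (Z \<omega>)))\<^sup>2) / L2_normsq (Z \<omega>)) \<in> borel_measurable M"
      by measurable
    show "AE \<omega> in M. ennreal (truncated_ratio l m s N (Z \<omega>)) \<le> ennreal C" for N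
      by (intro AE_I2 ennreal_leI C random_field_section[OF Z])
    show "(\<integral>\<^sup>+\<omega>. ennreal C \<partial>M) < \<infinity>" by (simp add: emeasure_space_1)
    show "AE \<omega> in M. (\<lambda>N. ennreal (truncated_ratio l m s N (Z \<omega>))) \<longlonglongrightarrow>
        ennreal ((cmod (wigner_coeff l m s (Z \<omega>)))\<^sup>2) / L2_normsq (Z \<omega>)"
      using fin pos AE_space
      by eventually_elim (rule truncated_ratio_tendsto[OF lms random_field_section[OF Z]])
  qed simp
  have "\<forall>\<^sub>F N in sequentially. (\<integral>\<^sup>+\<omega>. ennreal (truncated_ratio l m s N (X \<omega>)) \<partial>M) =
      (\<integral>\<^sup>+\<omega>. ennreal (truncated_ratio l m s N (Y \<omega>)) \<partial>M)"
    using eventually_gt_at_top[of 0]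
    by eventually_elim (rule nn_integral_truncated_ratio_eq[OF X Y law lms])
  then have "(\<lambda>N. \<integral>\<^sup>+\<omega>. ennreal (truncated_ratio l m s N (X \<omega>)) \<partial>M) \<longlonglongrightarrow>
      (\<integral>\<^sup>+\<omega>. ennreal ((cmod (wigner_coeff l m s (Y \<omega>)))\<^sup>2) / L2_normsq (Y \<omega>) \<partial>M)"
    using lim[OF Y fin(2) pos(2)] by (simp add: tendsto_cong)
  then show ?thesis using lim[OF X fin(1) pos(1)] LIMSEQ_unique by blast
qed

section \<open>Uniformity\<close>

lemma coefficient_moments_uniform_left:
  assumes X: "random_field M X" and l: "l \<in> half_nats" and s: "s \<in> weights l"
    and L2: "AE \<omega> in M. L2_normsq (X \<omega>) < \<infinity>"
    and w [measurable]: "w \<in> borel_measurable M"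
    and fin: "\<And>m. m \<in> weights l \<Longrightarrow>
      (\<integral>\<^sup>+\<omega>. ennreal ((cmod (wigner_coeff l m s (X \<omega>)))\<^sup>2) * w \<omega> \<partial>M) < \<infinity>"
    and inv: "\<And>h. h \<in> SU2 \<Longrightarrow>
      (\<integral>\<^sup>+\<omega>. ennreal ((cmod (wigner_coeff l (- l) s (\<lambda>x. X \<omega> (h ** x))))\<^sup>2) * w \<omega> \<partial>M) =
      (\<integral>\<^sup>+\<omega>. ennreal ((cmod (wigner_coeff l (- l) s (X \<omega>)))\<^sup>2) * w \<omega> \<partial>M)"
    and m: "m \<in> weights l"
  shows "(\<integral>\<^sup>+\<omega>. ennreal ((cmod (wigner_coeff l m s (X \<omega>)))\<^sup>2) * w \<omega> \<partial>M) =
    (\<integral>\<^sup>+\<omega>. ennreal ((cmod (wigner_coeff l (- l) s (X \<omega>)))\<^sup>2) * w \<omega> \<partial>M)"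
proof -
  obtain n where n: "2 * l = real n" using l by (rule half_nats_E)
  have W: "- l + real k \<in> weights l" if "k \<le> n" for k
    using that n by (auto simp: weights_eq_image[OF n])
  obtain k where k: "m = - l + real k" "k \<le> n" using m n by (auto simp: weights_def)
  let ?b = "\<lambda>k \<omega>. wigner_coeff l (- l + real k) s (X \<omega>)"
  have "(\<integral>\<^sup>+\<omega>. ennreal ((cmod (?b k \<omega>))\<^sup>2) * w \<omega> \<partial>M) = (\<integral>\<^sup>+\<omega>. ennreal ((cmod (?b 0 \<omega>))\<^sup>2) * w \<omega> \<partial>M)"
  proof (rule weighted_second_moments_equal[OF w _ _ _ k(2)])
    show "?b k \<in> borel_measurable M" if "k \<le> n" for k
      by (rule measurable_wigner_coeff_field[OF X l W[OF that] s])
    show "(\<integral>\<^sup>+\<omega>. ennreal ((cmod (?b k \<omega>))\<^sup>2) * w \<omega> \<partial>M) < \<infinity>" if "k \<le> n" for k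
      by (rule fin[OF W[OF that]])
    fix \<alpha> \<beta> assume ab: "(cmod \<alpha>)\<^sup>2 + (cmod \<beta>)\<^sup>2 = 1"
    \<comment> \<open>Chosen so that the conjugated lowest row of \<open>D(h)\<close> has the
      entries \<open>sqrt (n choose k) * \<beta> ^ k * \<alpha> ^ (n - k)\<close>.\<close>
    define h where "h = su2 (cnj \<alpha>) \<beta>"
    have h: "h \<in> SU2" unfolding h_def using ab by (intro su2_in_SU2) simp
    have "(\<integral>\<^sup>+\<omega>. ennreal ((cmod (\<Sum>k\<le>n. complex_of_real (sqrt (real (n choose k))) * \<beta> ^ k * \<alpha> ^ (n - k) * ?b k \<omega>))\<^sup>2)
        * w \<omega> \<partial>M) = (\<integral>\<^sup>+\<omega>. ennreal ((cmod (wigner_coeff l (- l) s (\<lambda>x. X \<omega> (conj_transpose h ** x))))\<^sup>2) * w \<omega> \<partial>M)"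
    proof (rule nn_integral_cong_AE, use L2 AE_space in eventually_elim)
      case (elim \<omega>)
      have "integrable SU2_vol (X \<omega>)"
        by (rule integrable_if_L2_normsq_finite[OF random_field_section[OF X elim(2)] elim(1)])
      then have "wigner_coeff l (- l) s (\<lambda>x. X \<omega> (conj_transpose h ** x)) =
          (\<Sum>k\<in>weights l. cnj (wigner_D l (- l) k h) * wigner_coeff l k s (X \<omega>))"
        by (rule wigner_coeff_mult_left[OF l lowest_weight[OF l] s h])
      also have "\<dots> = (\<Sum>k\<le>n. cnj (wigner_D l (- l) (- l + real k) h) * ?b k \<omega>)"
        by (rule sum_weights[OF n])
      also have "\<dots> = (\<Sum>k\<le>n. complex_of_real (sqrt (real (n choose k))) * \<beta> ^ k * \<alpha> ^ (n - k) * ?b k \<omega>)"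
      proof (rule sum.cong)
        fix k assume "k \<in> {..n}"
        then have k: "k \<le> n" by simp
        show "cnj (wigner_D l (- l) (- l + real k) h) * ?b k \<omega> =
            complex_of_real (sqrt (real (n choose k))) * \<beta> ^ k * \<alpha> ^ (n - k) * ?b k \<omega>"
          unfolding h_def wigner_D_lowest_row[OF l W[OF k]] wigner_psi_eq[OF n k] by simp
      qed simp
      finally show ?case by simp
    qed
    also have "\<dots> = (\<integral>\<^sup>+\<omega>. ennreal ((cmod (?b 0 \<omega>))\<^sup>2) * w \<omega> \<partial>M)"
      using inv[OF SU2_conj_transpose[OF h]] by simp
    finally show "(\<integral>\<^sup>+\<omega>. ennreal ((cmod (\<Sum>k\<le>n. complex_of_real (sqrt (real (n choose k))) * \<beta> ^ k * \<alpha> ^ (n - k) * ?b k \<omega>))\<^sup>2)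
        * w \<omega> \<partial>M) = \<dots>" .
  qed
  then show ?thesis by (simp add: k(1))
qed

lemma coefficient_moments_uniform_right:
  assumes X: "random_field M X" and l: "l \<in> half_nats" and m: "m \<in> weights l"
    and L2: "AE \<omega> in M. L2_normsq (X \<omega>) < \<infinity>"
    and w [measurable]: "w \<in> borel_measurable M"
    and fin: "\<And>s. s \<in> weights l \<Longrightarrow>
      (\<integral>\<^sup>+\<omega>. ennreal ((cmod (wigner_coeff l m s (X \<omega>)))\<^sup>2) * w \<omega> \<partial>M) < \<infinity>"
    and inv: "\<And>h. h \<in> SU2 \<Longrightarrow>
      (\<integral>\<^sup>+\<omega>. ennreal ((cmod (wigner_coeff l m (- l) (\<lambda>x. X \<omega> (x ** h))))\<^sup>2) * w \<omega> \<partial>M) =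
      (\<integral>\<^sup>+\<omega>. ennreal ((cmod (wigner_coeff l m (- l) (X \<omega>)))\<^sup>2) * w \<omega> \<partial>M)"
    and s: "s \<in> weights l"
  shows "(\<integral>\<^sup>+\<omega>. ennreal ((cmod (wigner_coeff l m s (X \<omega>)))\<^sup>2) * w \<omega> \<partial>M) =
    (\<integral>\<^sup>+\<omega>. ennreal ((cmod (wigner_coeff l m (- l) (X \<omega>)))\<^sup>2) * w \<omega> \<partial>M)"
proof -
  obtain n where n: "2 * l = real n" using l by (rule half_nats_E)
  have W: "- l + real k \<in> weights l" if "k \<le> n" for k
    using that n by (auto simp: weights_eq_image[OF n])
  obtain k where k: "s = - l + real k" "k \<le> n" using s n by (auto simp: weights_def)
  let ?b = "\<lambda>k \<omega>. wigner_coeff l m (- l + real k) (X \<omega>)"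
  have "(\<integral>\<^sup>+\<omega>. ennreal ((cmod (?b k \<omega>))\<^sup>2) * w \<omega> \<partial>M) = (\<integral>\<^sup>+\<omega>. ennreal ((cmod (?b 0 \<omega>))\<^sup>2) * w \<omega> \<partial>M)"
  proof (rule weighted_second_moments_equal[OF w _ _ _ k(2)])
    show "?b k \<in> borel_measurable M" if "k \<le> n" for k
      by (rule measurable_wigner_coeff_field[OF X l m W[OF that]])
    show "(\<integral>\<^sup>+\<omega>. ennreal ((cmod (?b k \<omega>))\<^sup>2) * w \<omega> \<partial>M) < \<infinity>" if "k \<le> n" for k
      by (rule fin[OF W[OF that]])
    fix \<alpha> \<beta> assume ab: "(cmod \<alpha>)\<^sup>2 + (cmod \<beta>)\<^sup>2 = 1"
    \<comment> \<open>The lowest column carries \<open>- \<beta>\<close> where the lowest row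
      carries the conjugate of \<open>\<beta>\<close>; this choice of \<open>h\<close> compensates
      for both the sign and the conjugation.\<close>
    define h where "h = su2 (cnj \<alpha>) (- cnj \<beta>)"
    have h: "h \<in> SU2" unfolding h_def using ab by (intro su2_in_SU2) simp
    have "(\<integral>\<^sup>+\<omega>. ennreal ((cmod (\<Sum>k\<le>n. complex_of_real (sqrt (real (n choose k))) * \<beta> ^ k * \<alpha> ^ (n - k) * ?b k \<omega>))\<^sup>2)
        * w \<omega> \<partial>M) = (\<integral>\<^sup>+\<omega>. ennreal ((cmod (wigner_coeff l m (- l) (\<lambda>x. X \<omega> (x ** conj_transpose h))))\<^sup>2) * w \<omega> \<partial>M)"
    proof (rule nn_integral_cong_AE, use L2 AE_space in eventually_elim)
      case (elim \<omega>)
      have "integrable SU2_vol (X \<omega>)"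
        by (rule integrable_if_L2_normsq_finite[OF random_field_section[OF X elim(2)] elim(1)])
      then have "wigner_coeff l m (- l) (\<lambda>x. X \<omega> (x ** conj_transpose h)) =
          (\<Sum>k\<in>weights l. cnj (wigner_D l k (- l) h) * wigner_coeff l m k (X \<omega>))"
        by (rule wigner_coeff_mult_right[OF l m lowest_weight[OF l] h])
      also have "\<dots> = (\<Sum>k\<le>n. cnj (wigner_D l (- l + real k) (- l) h) * ?b k \<omega>)"
        by (rule sum_weights[OF n])
      also have "\<dots> = (\<Sum>k\<le>n. complex_of_real (sqrt (real (n choose k))) * \<beta> ^ k * \<alpha> ^ (n - k) * ?b k \<omega>)"
      proof (rule sum.cong)
        fix k assume "k \<in> {..n}"
        then have k: "k \<le> n" by simp
        show "cnj (wigner_D l (- l + real k) (- l) h) * ?b k \<omega> =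
            complex_of_real (sqrt (real (n choose k))) * \<beta> ^ k * \<alpha> ^ (n - k) * ?b k \<omega>"
          unfolding h_def wigner_D_lowest_column[OF l W[OF k]] wigner_psi_eq[OF n k] by simp
      qed simp
      finally show ?case by simp
    qed
    also have "\<dots> = (\<integral>\<^sup>+\<omega>. ennreal ((cmod (?b 0 \<omega>))\<^sup>2) * w \<omega> \<partial>M)"
      using inv[OF SU2_conj_transpose[OF h]] by simp
    finally show "(\<integral>\<^sup>+\<omega>. ennreal ((cmod (\<Sum>k\<le>n. complex_of_real (sqrt (real (n choose k))) * \<beta> ^ k * \<alpha> ^ (n - k) * ?b k \<omega>))\<^sup>2)
        * w \<omega> \<partial>M) = \<dots>" .
  qed
  then show ?thesis by (simp add: k(1))
qed

section \<open>Invariance of the moments under weak and strong invariance of the field\<close>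

lemma weakly2_invariant_variance:
  assumes inv: "weakly2_invariant T M X" and trans: "\<And>g. g \<in> SU2 \<Longrightarrow> \<exists>\<phi>\<in>T. \<phi> (mat 1) = g"
    and g: "g \<in> SU2"
  shows "(\<integral>\<^sup>+\<omega>. ennreal ((cmod (X \<omega> g))\<^sup>2) \<partial>M) = ennreal (\<integral>\<omega>. (cmod (X \<omega> (mat 1)))\<^sup>2 \<partial>M)"
proof -
  have int: "integrable M (\<lambda>\<omega>. (cmod (X \<omega> g))\<^sup>2)" using inv g by (simp add: weakly2_invariant_def)
  obtain \<phi> where \<phi>: "\<phi> \<in> T" "\<phi> (mat 1) = g" using trans g by blast
  \<comment> \<open>Invariance of the covariance on the diagonal; as the translations act
    transitively, the variance at every \<open>g\<close> is that at the identity.\<close>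
  have "(\<integral>\<omega>. X \<omega> (\<phi> (mat 1)) * cnj (X \<omega> (\<phi> (mat 1))) \<partial>M) = (\<integral>\<omega>. X \<omega> (mat 1) * cnj (X \<omega> (mat 1)) \<partial>M)"
    using inv \<phi>(1) mat_1_in_SU2 unfolding weakly2_invariant_def by blast
  then have "(\<integral>\<omega>. X \<omega> g * cnj (X \<omega> g) \<partial>M) = (\<integral>\<omega>. X \<omega> (mat 1) * cnj (X \<omega> (mat 1)) \<partial>M)"
    by (simp only: \<phi>(2))
  then have "complex_of_real (\<integral>\<omega>. (cmod (X \<omega> g))\<^sup>2 \<partial>M) = complex_of_real (\<integral>\<omega>. (cmod (X \<omega> (mat 1)))\<^sup>2 \<partial>M)"
    by (simp only: complex_norm_square[symmetric] integral_complex_of_real)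
  then have "(\<integral>\<omega>. (cmod (X \<omega> g))\<^sup>2 \<partial>M) = (\<integral>\<omega>. (cmod (X \<omega> (mat 1)))\<^sup>2 \<partial>M)"
    unfolding of_real_eq_iff .
  then show ?thesis using nn_integral_eq_integral[OF int] by simp
qed

text \<open>The translated field has the same covariance kernel and the same constant variance, so
  \<open>second_moment_wigner_coeff\<close> gives the same value for both.\<close>

lemma weakly2_invariant_second_moment:
  assumes X: "random_field M X" and inv: "weakly2_invariant T M X"
    and var: "\<And>g. g \<in> SU2 \<Longrightarrow> (\<integral>\<^sup>+\<omega>. ennreal ((cmod (X \<omega> g))\<^sup>2) \<partial>M) = ennreal c"
    and \<phi>: "\<phi> \<in> T" "\<phi> \<in> measurable SU2_vol SU2_vol"
    and lms: "l \<in> half_nats" "m \<in> weights l" "s \<in> weights l"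
  shows "(\<integral>\<^sup>+\<omega>. ennreal ((cmod (wigner_coeff l m s (\<lambda>x. X \<omega> (\<phi> x))))\<^sup>2) \<partial>M) =
    (\<integral>\<^sup>+\<omega>. ennreal ((cmod (wigner_coeff l m s (X \<omega>)))\<^sup>2) \<partial>M)"
proof -
  have \<phi>_SU2: "\<phi> g \<in> SU2" if "g \<in> SU2" for g
    using measurable_space[OF \<phi>(2), of g] that by simp
  have kernel: "(\<integral>\<omega>. X \<omega> (\<phi> (fst p)) * cnj (X \<omega> (\<phi> (snd p))) \<partial>M) =
      (\<integral>\<omega>. X \<omega> (fst p) * cnj (X \<omega> (snd p)) \<partial>M)" if "p \<in> space (SU2_vol \<Otimes>\<^sub>M SU2_vol)" for p
    using inv \<phi>(1) that unfolding weakly2_invariant_def by (auto simp: space_pair_measure)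
  have "(\<integral>p. (\<integral>\<omega>. X \<omega> (\<phi> (fst p)) * cnj (X \<omega> (\<phi> (snd p))) \<partial>M) *
      (cnj (wigner_phi l m s (fst p)) * wigner_phi l m s (snd p)) \<partial>(SU2_vol \<Otimes>\<^sub>M SU2_vol)) =
    (\<integral>p. (\<integral>\<omega>. X \<omega> (fst p) * cnj (X \<omega> (snd p)) \<partial>M) *
      (cnj (wigner_phi l m s (fst p)) * wigner_phi l m s (snd p)) \<partial>(SU2_vol \<Otimes>\<^sub>M SU2_vol))"
    by (rule Bochner_Integration.integral_cong[OF refl]) (simp only: kernel)
  with second_moment_wigner_coeff[OF X var lms]
    second_moment_wigner_coeff[OF random_field_compose[OF X \<phi>(2)] var[OF \<phi>_SU2] lms]
  show ?thesis by simp
qed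

text \<open>Collects what the uniformity lemmas ask for, with weight 1; the factor
  \<open>* 1\<close> is there to match their form.\<close>

lemma weakly2_invariant_moments:
  assumes X: "random_field M X" and inv: "weakly2_invariant T M X"
    and trans: "\<And>g. g \<in> SU2 \<Longrightarrow> \<exists>\<phi>\<in>T. \<phi> (mat 1) = g"
  shows "AE \<omega> in M. L2_normsq (X \<omega>) < \<infinity>"
    and "\<lbrakk>l \<in> half_nats; m \<in> weights l; s \<in> weights l\<rbrakk> \<Longrightarrow>
      (\<integral>\<^sup>+\<omega>. ennreal ((cmod (wigner_coeff l m s (X \<omega>)))\<^sup>2) * 1 \<partial>M) < \<infinity>"
    and "\<lbrakk>l \<in> half_nats; m \<in> weights l; s \<in> weights l; \<phi> \<in> T; \<phi> \<in> measurable SU2_vol SU2_vol\<rbrakk> \<Longrightarrow>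
      (\<integral>\<^sup>+\<omega>. ennreal ((cmod (wigner_coeff l m s (\<lambda>x. X \<omega> (\<phi> x))))\<^sup>2) * 1 \<partial>M) =
      (\<integral>\<^sup>+\<omega>. ennreal ((cmod (wigner_coeff l m s (X \<omega>)))\<^sup>2) * 1 \<partial>M)"
proof -
  note var = weakly2_invariant_variance[OF inv trans]
  note [measurable] = measurable_L2_normsq_field[OF X]
  have fin: "(\<integral>\<^sup>+\<omega>. L2_normsq (X \<omega>) \<partial>M) < \<infinity>"
    by (rule nn_integral_L2_normsq_field[OF X var])
  then show "AE \<omega> in M. L2_normsq (X \<omega>) < \<infinity>"
    using nn_integral_PInf_AE[of "\<lambda>\<omega>. L2_normsq (X \<omega>)" M] by (simp add: less_top)
  show "(\<integral>\<^sup>+\<omega>. ennreal ((cmod (wigner_coeff l m s (X \<omega>)))\<^sup>2) * 1 \<partial>M) < \<infinity>"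
    if lms: "l \<in> half_nats" "m \<in> weights l" "s \<in> weights l"
  proof -
    obtain C where C: "\<And>f. f \<in> borel_measurable SU2_vol \<Longrightarrow>
        ennreal ((cmod (wigner_coeff l m s f))\<^sup>2) \<le> ennreal C * L2_normsq f"
      using wigner_coeff_le_L2_normsq[OF lms] by blast
    have "(\<integral>\<^sup>+\<omega>. ennreal ((cmod (wigner_coeff l m s (X \<omega>)))\<^sup>2) * 1 \<partial>M) \<le>
        (\<integral>\<^sup>+\<omega>. ennreal C * L2_normsq (X \<omega>) \<partial>M)"
      by (intro nn_integral_mono) (simp add: C random_field_section[OF X])
    also have "\<dots> < \<infinity>" using fin by (simp add: nn_integral_cmult ennreal_mult_less_top)
    finally show ?thesis .
  qed
  show "(\<integral>\<^sup>+\<omega>. ennreal ((cmod (wigner_coeff l m s (\<lambda>x. X \<omega> (\<phi> x))))\<^sup>2) * 1 \<partial>M) =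
      (\<integral>\<^sup>+\<omega>. ennreal ((cmod (wigner_coeff l m s (X \<omega>)))\<^sup>2) * 1 \<partial>M)"
    if "l \<in> half_nats" "m \<in> weights l" "s \<in> weights l" "\<phi> \<in> T" "\<phi> \<in> measurable SU2_vol SU2_vol"
    using weakly2_invariant_second_moment[OF X inv var that(4,5,1-3)] by simp
qed

text \<open>Cauchy-Schwarz bounds the ratio by a constant on almost every path.\<close>

lemma strong_moment_finite:
  assumes X: "random_field M X" and lms: "l \<in> half_nats" "m \<in> weights l" "s \<in> weights l"
    and L2: "AE \<omega> in M. L2_normsq (X \<omega>) < \<infinity>"
  shows "(\<integral>\<^sup>+\<omega>. ennreal ((cmod (wigner_coeff l m s (X \<omega>)))\<^sup>2) * inverse (L2_normsq (X \<omega>)) \<partial>M) < \<infinity>"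
proof -
  interpret prob_space M using X by (simp add: random_field_iff)
  obtain C where C: "\<And>f. f \<in> borel_measurable SU2_vol \<Longrightarrow>
      ennreal ((cmod (wigner_coeff l m s f))\<^sup>2) \<le> ennreal C * L2_normsq f"
    using wigner_coeff_le_L2_normsq[OF lms] by blast
  have "(\<integral>\<^sup>+\<omega>. ennreal ((cmod (wigner_coeff l m s (X \<omega>)))\<^sup>2) * inverse (L2_normsq (X \<omega>)) \<partial>M) \<le>
      (\<integral>\<^sup>+\<omega>. ennreal C \<partial>M)"
  proof (rule nn_integral_mono_AE, use L2 AE_space in eventually_elim)
    case (elim \<omega>)
    have le: "ennreal ((cmod (wigner_coeff l m s (X \<omega>)))\<^sup>2) \<le> ennreal C * L2_normsq (X \<omega>)"
      by (rule C[OF random_field_section[OF X elim(2)]])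
    \<comment> \<open>If the norm is 0, its inverse is infinite, but the coefficient is then 0 by
      \<open>le\<close>, and 0 times infinity is 0 in \<open>ennreal\<close>.\<close>
    then show ?case
    proof (cases "L2_normsq (X \<omega>) = 0")
      case False
      have "ennreal ((cmod (wigner_coeff l m s (X \<omega>)))\<^sup>2) * inverse (L2_normsq (X \<omega>)) \<le>
          ennreal C * L2_normsq (X \<omega>) * inverse (L2_normsq (X \<omega>))"
        using le by (rule mult_right_mono) simp
      also have "\<dots> = ennreal C * (L2_normsq (X \<omega>) / L2_normsq (X \<omega>))"
        by (simp only: divide_ennreal_def mult.assoc)
      also have "\<dots> = ennreal C" using False elim(1) by (simp add: ennreal_divide_self)
      finally show ?thesis .
    qed simp
  qed
  also have "\<dots> < \<infinity>" by (simp add: emeasure_space_1)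
  finally show ?thesis .
qed

text \<open>The translated path has the same norm as the original one, so the weight on the left is
  also the reciprocal squared norm of the translated field, and equality of laws applies to the
  ratio.\<close>

lemma strongly_invariant_moment:
  assumes X: "random_field M X" and lms: "l \<in> half_nats" "m \<in> weights l" "s \<in> weights l"
    and L2: "AE \<omega> in M. L2_normsq (X \<omega>) < \<infinity>" "AE \<omega> in M. L2_normsq (X \<omega>) > 0"
    and \<phi>: "\<phi> \<in> measurable SU2_vol SU2_vol" "distr SU2_vol SU2_vol \<phi> = SU2_vol"
    and law: "field_law M (\<lambda>\<omega> x. X \<omega> (\<phi> x)) = field_law M X"
  shows "(\<integral>\<^sup>+\<omega>. ennreal ((cmod (wigner_coeff l m s (\<lambda>x. X \<omega> (\<phi> x))))\<^sup>2) * inverse (L2_normsq (X \<omega>)) \<partial>M) =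
    (\<integral>\<^sup>+\<omega>. ennreal ((cmod (wigner_coeff l m s (X \<omega>)))\<^sup>2) * inverse (L2_normsq (X \<omega>)) \<partial>M)"
proof -
  have eq: "L2_normsq (\<lambda>x. X \<omega> (\<phi> x)) = L2_normsq (X \<omega>)" if "\<omega> \<in> space M" for \<omega>
    by (rule L2_normsq_distr[OF \<phi> random_field_section[OF X that]])
  have "AE \<omega> in M. L2_normsq (\<lambda>x. X \<omega> (\<phi> x)) < \<infinity>" "AE \<omega> in M. L2_normsq (\<lambda>x. X \<omega> (\<phi> x)) > 0"
    using L2 by (auto simp: eq cong: AE_cong)
  then have "(\<integral>\<^sup>+\<omega>. ennreal ((cmod (wigner_coeff l m s (\<lambda>x. X \<omega> (\<phi> x))))\<^sup>2) / L2_normsq (\<lambda>x. X \<omega> (\<phi> x)) \<partial>M) =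
    (\<integral>\<^sup>+\<omega>. ennreal ((cmod (wigner_coeff l m s (X \<omega>)))\<^sup>2) / L2_normsq (X \<omega>) \<partial>M)"
    by (intro expected_ratio_law[OF random_field_compose[OF X \<phi>(1)] X law lms] L2)
  moreover have "(\<integral>\<^sup>+\<omega>. ennreal ((cmod (wigner_coeff l m s (\<lambda>x. X \<omega> (\<phi> x))))\<^sup>2) / L2_normsq (\<lambda>x. X \<omega> (\<phi> x)) \<partial>M) =
    (\<integral>\<^sup>+\<omega>. ennreal ((cmod (wigner_coeff l m s (\<lambda>x. X \<omega> (\<phi> x))))\<^sup>2) / L2_normsq (X \<omega>) \<partial>M)"
    by (rule nn_integral_cong) (simp only: eq)
  ultimately show ?thesis by (simp only: divide_ennreal_def)
qed

lemma weak_spectral_prob_uniform_left: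
  assumes X: "random_field M X" and inv: "weakly2_left_invariant M X"
    and l: "l \<in> half_nats" and s: "s \<in> weights l"
  shows "uniform_on (weak_spectral_prob M X) ({l} \<times> weights l \<times> {s})"
proof -
  let ?T = "(\<lambda>h x. h ** x) ` SU2"
  have inv': "weakly2_invariant ?T M X" using inv by (simp add: weakly2_left_invariant_def)
  have trans: "\<exists>\<phi>\<in>?T. \<phi> (mat 1) = g" if "g \<in> SU2" for g using that by (auto simp: matrix_mul_rid)
  note moments = weakly2_invariant_moments[OF X inv' trans]
  have "(\<integral>\<^sup>+\<omega>. ennreal ((cmod (wigner_coeff l m s (X \<omega>)))\<^sup>2) * 1 \<partial>M) =
      (\<integral>\<^sup>+\<omega>. ennreal ((cmod (wigner_coeff l (- l) s (X \<omega>)))\<^sup>2) * 1 \<partial>M)" if "m \<in> weights l" for m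
  proof (rule coefficient_moments_uniform_left[OF X l s moments(1) _ _ _ that])
    fix h assume h: "h \<in> SU2"
    show "(\<integral>\<^sup>+\<omega>. ennreal ((cmod (wigner_coeff l (- l) s (\<lambda>x. X \<omega> (h ** x))))\<^sup>2) * 1 \<partial>M) =
        (\<integral>\<^sup>+\<omega>. ennreal ((cmod (wigner_coeff l (- l) s (X \<omega>)))\<^sup>2) * 1 \<partial>M)"
      using h by (intro moments(3) l s lowest_weight measurable_SU2_vol_mult_left imageI)
  qed (assumption | rule borel_measurable_const moments(2) l s)+
  then show ?thesis
    using l s unfolding uniform_on_def
    by (auto simp: emeasure_weak_spectral_prob_singleton spectral_index_def)
qed

lemma weak_spectral_prob_uniform_right:
  assumes X: "random_field M X" and inv: "weakly2_right_invariant M X"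
    and l: "l \<in> half_nats" and m: "m \<in> weights l"
  shows "uniform_on (weak_spectral_prob M X) ({l} \<times> {m} \<times> weights l)"
proof -
  let ?T = "(\<lambda>h x. x ** h) ` SU2"
  have inv': "weakly2_invariant ?T M X" using inv by (simp add: weakly2_right_invariant_def)
  have trans: "\<exists>\<phi>\<in>?T. \<phi> (mat 1) = g" if "g \<in> SU2" for g using that by (auto simp: matrix_mul_lid)
  note moments = weakly2_invariant_moments[OF X inv' trans]
  have "(\<integral>\<^sup>+\<omega>. ennreal ((cmod (wigner_coeff l m s (X \<omega>)))\<^sup>2) * 1 \<partial>M) =
      (\<integral>\<^sup>+\<omega>. ennreal ((cmod (wigner_coeff l m (- l) (X \<omega>)))\<^sup>2) * 1 \<partial>M)" if "s \<in> weights l" for s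
  proof (rule coefficient_moments_uniform_right[OF X l m moments(1) _ _ _ that])
    fix h assume h: "h \<in> SU2"
    show "(\<integral>\<^sup>+\<omega>. ennreal ((cmod (wigner_coeff l m (- l) (\<lambda>x. X \<omega> (x ** h))))\<^sup>2) * 1 \<partial>M) =
        (\<integral>\<^sup>+\<omega>. ennreal ((cmod (wigner_coeff l m (- l) (X \<omega>)))\<^sup>2) * 1 \<partial>M)"
      using h by (intro moments(3) l m lowest_weight measurable_SU2_vol_mult_right imageI)
  qed (assumption | rule borel_measurable_const moments(2) l m)+
  then show ?thesis
    using l m unfolding uniform_on_def
    by (auto simp: emeasure_weak_spectral_prob_singleton spectral_index_def)
qed

lemma strong_spectral_prob_uniform_left:
  assumes X: "random_field M X" and L2: "square_integrable_field M X" "AE \<omega> in M. L2_normsq (X \<omega>) > 0"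
    and inv: "strongly_left_invariant M X"
    and l: "l \<in> half_nats" and s: "s \<in> weights l"
  shows "uniform_on (strong_spectral_prob M X) ({l} \<times> weights l \<times> {s})"
proof -
  have L2': "AE \<omega> in M. L2_normsq (X \<omega>) < \<infinity>" using L2(1) by (simp add: square_integrable_field_def)
  \<comment> \<open>The definition translates by \<open>matrix_inv g\<close>; taking for
    \<open>g\<close> the inverse of \<open>h\<close> yields the translation by
    \<open>h\<close>.\<close>
  have law: "field_law M (\<lambda>\<omega> x. X \<omega> (h ** x)) = field_law M X" if h: "h \<in> SU2" for h
    using inv SU2_conj_transpose[OF h] matrix_inv_SU2[OF SU2_conj_transpose[OF h]]
    unfolding strongly_left_invariant_def by (metis conj_transpose_conj_transpose)
  note [measurable] = measurable_L2_normsq_field[OF X]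
  have "(\<integral>\<^sup>+\<omega>. ennreal ((cmod (wigner_coeff l m s (X \<omega>)))\<^sup>2) * inverse (L2_normsq (X \<omega>)) \<partial>M) =
      (\<integral>\<^sup>+\<omega>. ennreal ((cmod (wigner_coeff l (- l) s (X \<omega>)))\<^sup>2) * inverse (L2_normsq (X \<omega>)) \<partial>M)"
    if "m \<in> weights l" for m
  proof (rule coefficient_moments_uniform_left[OF X l s L2' _ _ _ that])
    show "(\<lambda>\<omega>. inverse (L2_normsq (X \<omega>))) \<in> borel_measurable M" by measurable
  qed (intro strong_moment_finite strongly_invariant_moment X l s lowest_weight L2 L2' law
      measurable_SU2_vol_mult_left distr_SU2_vol_mult_left; assumption)+
  then show ?thesis
    using l s unfolding uniform_on_def
    by (auto simp: emeasure_strong_spectral_prob_singleton spectral_index_def divide_ennreal_def)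
qed

lemma strong_spectral_prob_uniform_right:
  assumes X: "random_field M X" and L2: "square_integrable_field M X" "AE \<omega> in M. L2_normsq (X \<omega>) > 0"
    and inv: "strongly_right_invariant M X"
    and l: "l \<in> half_nats" and m: "m \<in> weights l"
  shows "uniform_on (strong_spectral_prob M X) ({l} \<times> {m} \<times> weights l)"
proof -
  have L2': "AE \<omega> in M. L2_normsq (X \<omega>) < \<infinity>" using L2(1) by (simp add: square_integrable_field_def)
  have law: "field_law M (\<lambda>\<omega> x. X \<omega> (x ** h)) = field_law M X" if h: "h \<in> SU2" for h
    using inv h unfolding strongly_right_invariant_def by blast
  note [measurable] = measurable_L2_normsq_field[OF X]
  have "(\<integral>\<^sup>+\<omega>. ennreal ((cmod (wigner_coeff l m s (X \<omega>)))\<^sup>2) * inverse (L2_normsq (X \<omega>)) \<partial>M) =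
      (\<integral>\<^sup>+\<omega>. ennreal ((cmod (wigner_coeff l m (- l) (X \<omega>)))\<^sup>2) * inverse (L2_normsq (X \<omega>)) \<partial>M)"
    if "s \<in> weights l" for s
  proof (rule coefficient_moments_uniform_right[OF X l m L2' _ _ _ that])
    show "(\<lambda>\<omega>. inverse (L2_normsq (X \<omega>))) \<in> borel_measurable M" by measurable
  qed (intro strong_moment_finite strongly_invariant_moment X l m lowest_weight L2 L2' law
      measurable_SU2_vol_mult_right distr_SU2_vol_mult_right; assumption)+
  then show ?thesis
    using l m unfolding uniform_on_def
    by (auto simp: emeasure_strong_spectral_prob_singleton spectral_index_def divide_ennreal_def)
qed

theorem theorem67:
  fixes M :: "'w measure" and X :: "'w \<Rightarrow> complex^2^2 \<Rightarrow> complex"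
  assumes "random_field M X"
  shows
    "(weakly2_left_invariant M X \<and> (\<integral>\<^sup>+\<omega>. L2_normsq (X \<omega>) \<partial>M) > 0 \<longrightarrow>
        (\<forall>l\<in>half_nats. \<forall>s\<in>weights l.
           uniform_on (weak_spectral_prob M X) ({l} \<times> weights l \<times> {s}))) \<and>
     (square_integrable_field M X \<and> strongly_left_invariant M X \<and>
      (AE \<omega> in M. L2_normsq (X \<omega>) > 0) \<longrightarrow>
        (\<forall>l\<in>half_nats. \<forall>s\<in>weights l.
           uniform_on (strong_spectral_prob M X) ({l} \<times> weights l \<times> {s}))) \<and>
     (weakly2_right_invariant M X \<and> (\<integral>\<^sup>+\<omega>. L2_normsq (X \<omega>) \<partial>M) > 0 \<longrightarrow>
        (\<forall>l\<in>half_nats. \<forall>m\<in>weights l.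
           uniform_on (weak_spectral_prob M X) ({l} \<times> {m} \<times> weights l))) \<and>
     (square_integrable_field M X \<and> strongly_right_invariant M X \<and>
      (AE \<omega> in M. L2_normsq (X \<omega>) > 0) \<longrightarrow>
        (\<forall>l\<in>half_nats. \<forall>m\<in>weights l.
           uniform_on (strong_spectral_prob M X) ({l} \<times> {m} \<times> weights l)))"
  using assms weak_spectral_prob_uniform_left strong_spectral_prob_uniform_left
    weak_spectral_prob_uniform_right strong_spectral_prob_uniform_right by blast

end
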